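(* Let $M>4$ and $\alpha>3$ be fixed, and suppose $\epsilon_i^{(j)}$, $i=1,\dots,n$, $j=1,\dots,m$, are $(M,\alpha)$-short range dependent random variables. Then there exists a constant $C$, not depending on $n,m$ and independent of the coefficients below, such that for all real numbers $a_i^{(j)}$, $i=1,\dots,n$, $j=1,\dots,m$, $$\Big\Vert\sum_{i=1}^n\sum_{j=1}^m a_i^{(j)}\epsilon_i^{(j)}\Big\Vert_M\leq C\sqrt{\sum_{i=1}^n\sum_{j=1}^m \big(a_i^{(j)}\big)^2}.$$
   Context: Notation: $\Vert X\Vert_M=(\mathbf{E}|X|^M)^{1/M}$. Random field. Let $e_i^{(j)}$, $i,j\in\mathbf{Z}$, be independent (not necessarily identically distributed) random variables. For positive integers $n,m$ and $1\le i\le n$, $1\le j\le m$, let $\epsilon_i^{(j)}=G_{i,n}^{(j),m}(e_{i-u}^{(j-v)};\,u,v\in\mathbf{Z})$ for a measurable function $G_{i,n}^{(j),m}$ (so $\epsilon_i^{(j)}$ may depend on $n,m$; this is suppressed in the notation). Dependence measure. Let $e_i^{(j)\dagger}$, $i,j\in\mathbf{Z}$, be independent random variables, independent of all $e_p^{(q)}$, with $e_i^{(j)\dagger}$ having the same distribution as $e_i^{(j)}$. For $p,q\in\mathbf{Z}$ let $\epsilon_{i,p}^{(j),(q)}$ be obtained from $\epsilon_i^{(j)}=G_{i,n}^{(j),m}(\cdot)$ by replacing the single innovation $e_{i+p}^{(j+q)}$ by $e_{i+p}^{(j+q)\dagger}$. Put $\delta_p^{(q)}=\max_{1\le i\le n,\,1\le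 j\le m}\Vert\epsilon_i^{(j)}-\epsilon_{i,p}^{(j),(q)}\Vert_M$. Definition. $\epsilon_i^{(j)}$ is called $(M,\alpha)$-short range dependent if $\epsilon_i^{(j)}=G_{i,n}^{(j),m}(e_{i-u}^{(j-v)};\,u,v\in\mathbf{Z})$ for all $1\le i\le n$, $1\le j\le m$, with independent random variables $e_i^{(j)}$, $i,j\in\mathbf{Z}$, and measurable functions $G_{i,n}^{(j),m}$, and $\mathbf{E}\epsilon_i^{(j)}=0$ for all $i,j$, $\max_{1\le i\le n,1\le j\le m}\Vert\epsilon_i^{(j)}\Vert_M=O(1)$, and $\sup_{p,q\in\mathbf{Z}}(1+|p|+|q|)^\alpha\delta_p^{(q)}=O(1)$, where $O(1)$ means bounded by a constant not depending on $n,m$. *)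

theory Defs
  imports "HOL-Probability.Probability"
begin

(* The norm (E |X|^M)^(1/M), valued in ennreal so that an infinite moment gives infinity
   rather than the default value 0 of a real-valued integral. *)
definition moment_norm :: "'a measure \<Rightarrow> real \<Rightarrow> ('a \<Rightarrow> real) \<Rightarrow> ennreal" where
  "moment_norm P M X =
     (let I = \<integral>\<^sup>+ \<omega>. ennreal (\<bar>X \<omega>\<bar> powr M) \<partial>P
      in if I = \<infinity> then \<infinity> else ennreal (enn2real I powr (1 / M)))"

(* e (i, j) is the innovation at site (i, j) and e' is the independent copy of the whole field;
   independence of the disjoint union of the two families says that the e's are independent,
   the copies are independent, and the two families are independent of each other. *)
definition innovations_with_copy ::
    "'a measure \<Rightarrow> (int \<times> int \<Rightarrow> 'a \<Rightarrow> real) \<Rightarrow> (int \<times> int \<Rightarrow> 'a \<Rightarrow> real) \<Rightarrow> bool" where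
  "innovations_with_copy P e e' \<longleftrightarrow>
     prob_space.indep_vars P (\<lambda>_. borel) (case_sum e e') UNIV \<and>
     (\<forall>k. distr P borel (e' k) = distr P borel (e k))"

(* The array of values fed into the filter at site (i, j): its entry at lag (u, v) is the
   innovation at (i - u, j - v). *)
definition lagged :: "(int \<times> int \<Rightarrow> 'a \<Rightarrow> real) \<Rightarrow> nat \<Rightarrow> nat \<Rightarrow> 'a \<Rightarrow> int \<times> int \<Rightarrow> real" where
  "lagged e i j \<omega> = (\<lambda>(u, v). e (int i - u, int j - v) \<omega>)"

(* The filter for sample size (n, m) at site (i, j) is G n m i j. *)
type_synonym filter_array = "nat \<Rightarrow> nat \<Rightarrow> nat \<Rightarrow> nat \<Rightarrow> (int \<times> int \<Rightarrow> real) \<Rightarrow> real"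

definition dependence_measure ::
    "'a measure \<Rightarrow> real \<Rightarrow> filter_array \<Rightarrow> (int \<times> int \<Rightarrow> 'a \<Rightarrow> real) \<Rightarrow> (int \<times> int \<Rightarrow> 'a \<Rightarrow> real) \<Rightarrow>
      nat \<Rightarrow> nat \<Rightarrow> int \<Rightarrow> int \<Rightarrow> ennreal" where
  "dependence_measure P M G e e' n m p q =
     (MAX (i, j) \<in> {1..n} \<times> {1..m}.
        let k = (int i + p, int j + q) in
        moment_norm P M
          (\<lambda>\<omega>. G n m i j (lagged e i j \<omega>) - G n m i j (lagged (e(k := e' k)) i j \<omega>)))"

(* eps n m i j is the variable at site (i, j) of the n x m field. The innovations do not depend
   on (n, m); each O(1) is a bound by one real constant valid for all n, m >= 1. *)
definition short_range_dependent ::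
    "'a measure \<Rightarrow> real \<Rightarrow> real \<Rightarrow> (nat \<Rightarrow> nat \<Rightarrow> nat \<Rightarrow> nat \<Rightarrow> 'a \<Rightarrow> real) \<Rightarrow> bool" where
  "short_range_dependent P M \<alpha> eps \<longleftrightarrow>
     (\<exists>e e' G.
        innovations_with_copy P e e' \<and>
        (\<forall>n\<ge>1. \<forall>m\<ge>1. \<forall>i\<in>{1..n}. \<forall>j\<in>{1..m}.
           G n m i j \<in> borel_measurable (\<Pi>\<^sub>M k\<in>UNIV. borel) \<and>
           (\<forall>\<omega>\<in>space P. eps n m i j \<omega> = G n m i j (lagged e i j \<omega>)) \<and>
           has_bochner_integral P (eps n m i j) 0) \<and>
        (\<exists>K::real. \<forall>n\<ge>1. \<forall>m\<ge>1.
           (MAX (i, j) \<in> {1..n} \<times> {1..m}. moment_norm P M (eps n m i j)) \<le> ennreal K) \<and>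
        (\<exists>K::real. \<forall>n\<ge>1. \<forall>m\<ge>1.
           (SUP (p, q). ennreal ((1 + \<bar>real_of_int p\<bar> + \<bar>real_of_int q\<bar>) powr \<alpha>)
              * dependence_measure P M G e e' n m p q) \<le> ennreal K))"

end

theory Submission
  imports Defs
begin

text \<open>
  Fix the sample size and write the weighted sum as \<open>S = g (e)\<close>, a function of all innovations.
  Revealing the innovations one after the other splits \<open>S\<close> into martingale differences, and the
  difference that belongs to the innovation at \<open>k\<close> is the conditional expectation of the change of
  \<open>S\<close> when \<open>e k\<close> is replaced by its copy. By Minkowski's inequality
  (\<open>moment_linear_combination_le\<close>) this change has norm at most
  \<open>b k = (\<Sum>s. \<bar>a s\<bar> * c (k - s))\<close>, where \<open>c\<close> is the assumed bound on the dependence measure.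
  For \<open>p \<ge> 2\<close>, in particular for \<open>p = M\<close>, a Burkholder-type inequality in \<open>L\<^sup>p\<close> bounds
  \<open>\<parallel>S\<parallel>\<^sup>2\<close> by a constant times \<open>\<Sum>k. (b k)\<^sup>2\<close> (\<open>moment_le_resampling\<close>, \<open>moment_le_replacement\<close>), and Young's
  convolution inequality (\<open>convolution_square_sum_le\<close>) bounds that sum by
  \<open>(\<Sum>x. c x)\<^sup>2 * (\<Sum>s. (a s)\<^sup>2)\<close>. The sum of \<open>c\<close> over the lattice is finite because
  \<open>c (u, v)\<close> is a multiple of \<open>(1 + \<bar>u\<bar> + \<bar>v\<bar>) powr - \<alpha>\<close> and \<open>\<alpha>\<close> is larger than
  the dimension 2.

  The martingale inequality needs no sharp constant, and this makes it elementary. A second order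
  expansion gives
  \<open>\<bar>x + y\<bar> powr p \<le> \<bar>x\<bar> powr p + p * sgn x * \<bar>x\<bar> powr (p - 1) * y + C * (\<bar>x\<bar> powr (p - 2) * y\<^sup>2 + \<bar>y\<bar> powr p)\<close>;
  for a martingale difference \<open>Y\<close> the linear term has mean zero, the mixed term is handled by
  Hoelder's inequality, and an induction over the revealed innovations closes
  (\<open>moment_recursion_step\<close>).

  Conditional expectations are explicit on the product space of the innovations: given the
  coordinates in \<open>J\<close>, one integrates over the others (\<open>cond_avg\<close>). The facts needed
  about them follow from Fubini's theorem, Jensen's inequality and one symmetry. Take two independent points of the product space and exchange
  some of their coordinates; the joint law does not change (\<open>distr_exchange_off\<close>). Since there are
  infinitely many innovations, the induction only reaches the conditional expectation of \<open>S\<close> given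
  finitely many of them; these converge to \<open>S\<close> almost everywhere along a sequence
  (\<open>cond_avg_AE_limit\<close>), and Fatou's lemma finishes the proof.
\<close>

section \<open>Elementary inequalities for powers\<close>

lemma convex_on_abs_powr:
  assumes "p \<ge> (1::real)"
  shows "convex_on UNIV (\<lambda>x::real. \<bar>x\<bar> powr p)"
proof (rule convex_onI)
  fix t x y :: real assume t: "0 < t" "t < 1"
  have small: "s powr p \<le> s" if "0 < s" "s < 1" for s :: real
    using powr_mono'[of 1 p s] that assms by simp
  have "\<bar>(1 - t) *\<^sub>R x + t *\<^sub>R y\<bar> \<le> (1 - t) * \<bar>x\<bar> + t * \<bar>y\<bar>"
    using t abs_triangle_ineq[of "(1 - t) * x" "t * y"] by (simp add: abs_mult)
  then have "\<bar>(1 - t) *\<^sub>R x + t *\<^sub>R y\<bar> powr p \<le> ((1 - t) * \<bar>x\<bar> + t * \<bar>y\<bar>) powr p"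
    using assms by (intro powr_mono2) auto
  also have "\<dots> \<le> (1 - t) * \<bar>x\<bar> powr p + t * \<bar>y\<bar> powr p"
  proof (cases "x = 0 \<or> y = 0")
    case True
    have "((1 - t) * \<bar>x\<bar>) powr p \<le> (1 - t) * \<bar>x\<bar> powr p"
         "(t * \<bar>y\<bar>) powr p \<le> t * \<bar>y\<bar> powr p"
      using t small[of t] small[of "1 - t"] by (auto simp: powr_mult intro!: mult_right_mono)
    with True t show ?thesis by auto
  next
    case False
    then show ?thesis
      using convex_onD[OF powr_convex[OF assms], of t "\<bar>x\<bar>" "\<bar>y\<bar>"] t by simp
  qed
  finally show "\<bar>(1 - t) *\<^sub>R x + t *\<^sub>R y\<bar> powr p \<le> (1 - t) * \<bar>x\<bar> powr p + t * \<bar>y\<bar> powr p" .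
qed simp

lemma abs_add_powr_le:
  assumes "p > (0::real)"
  shows "\<bar>x + y\<bar> powr p \<le> 2 powr p * (\<bar>x\<bar> powr p + \<bar>y::real\<bar> powr p)"
proof -
  have "\<bar>x + y\<bar> powr p \<le> (2 * max \<bar>x\<bar> \<bar>y\<bar>) powr p"
    using assms by (intro powr_mono2) auto
  also have "\<dots> = 2 powr p * max \<bar>x\<bar> \<bar>y\<bar> powr p" by (simp add: powr_mult)
  also have "\<dots> \<le> 2 powr p * (\<bar>x\<bar> powr p + \<bar>y\<bar> powr p)"
    by (intro mult_left_mono) (auto simp: max_def)
  finally show ?thesis .
qed

text \<open>A form of Young's inequality in which the larger of \<open>u\<close> and \<open>v\<close> simply replaces the other
  factor. It serves as a substitute for Hoelder's inequality when constants do not matter.\<close>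
lemma powr_mult_powr_le:
  assumes "0 \<le> a" "0 \<le> b" "0 \<le> u" "0 \<le> (v::real)"
  shows "u powr a * v powr b \<le> u powr (a + b) + v powr (a + b)"
proof (cases "u \<le> v")
  case True
  have "u powr a * v powr b \<le> v powr a * v powr b"
    using assms True by (intro mult_right_mono powr_mono2) auto
  then show ?thesis by (simp add: powr_add add_increasing)
next
  case False
  have "u powr a * v powr b \<le> u powr a * u powr b"
    using assms False by (intro mult_left_mono powr_mono2) auto
  then show ?thesis by (simp add: powr_add add_increasing2)
qed

text \<open>The value only has to dominate the constants of both cases in \<open>abs_add_powr_expand\<close>; the
  summand 1 makes it at least 1, as \<open>moment_recursion_step\<close> requires.\<close>
definition taylor_const :: "real \<Rightarrow> real" where
  "taylor_const p = 2 powr p + p + p\<^sup>2 * exp p + 1"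

lemma taylor_const_ge_1: "p \<ge> 0 \<Longrightarrow> taylor_const p \<ge> 1"
  by (simp add: taylor_const_def)

text \<open>If \<open>\<bar>y\<bar> < \<bar>x\<bar>\<close>, scaling by \<open>x\<close> reduces the claim to
  \<open>(1 + t) powr p \<le> 1 + p * t + C * t\<^sup>2\<close> for \<open>\<bar>t\<bar> < 1\<close>. This follows from
  \<open>ln (1 + t) \<le> t\<close> and the second order expansion of \<open>exp\<close>. Otherwise every term is
  at most a multiple of \<open>\<bar>y\<bar> powr p\<close>.\<close>
lemma abs_add_powr_expand:
  fixes x y p :: real
  assumes p: "p \<ge> 2"
  shows "\<bar>x + y\<bar> powr p \<le> \<bar>x\<bar> powr p + p * (sgn x * \<bar>x\<bar> powr (p - 1) * y)
           + taylor_const p * (\<bar>x\<bar> powr (p - 2) * \<bar>y\<bar> powr 2 + \<bar>y\<bar> powr p)"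
proof (cases "\<bar>y\<bar> < \<bar>x\<bar>")
  case True
  define t where "t = y / x"
  have x: "x \<noteq> 0" and t: "\<bar>t\<bar> < 1" and y: "y = t * x" using True by (auto simp: t_def)
  have "(1 + t) powr p = exp (p * ln (1 + t))" using t by (simp add: powr_def)
  also have "\<dots> \<le> exp (p * t)" using t p by (simp add: ln_add_one_self_le_self2)
  also have "\<dots> \<le> 1 + p * t + p\<^sup>2 * exp p * t\<^sup>2"
  proof -
    obtain s where s: "\<bar>s\<bar> \<le> \<bar>p * t\<bar>"
      and e: "exp (p * t) = (\<Sum>m<2. (p * t) ^ m / fact m) + exp s / fact 2 * (p * t)\<^sup>2"
      using Maclaurin_exp_le by blast
    have "\<bar>p * t\<bar> \<le> p" using t p by (simp add: abs_mult mult_left_le)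
    then have "exp s / 2 \<le> exp p"
      using s by (smt (verit) exp_le_cancel_iff exp_gt_zero field_sum_of_halves)
    then have "exp s / 2 * (p * t)\<^sup>2 \<le> exp p * (p * t)\<^sup>2" by (rule mult_right_mono) simp
    then show ?thesis using e by (simp add: numeral_2_eq_2 power_mult_distrib mult_ac)
  qed
  finally have *: "(1 + t) powr p \<le> 1 + p * t + p\<^sup>2 * exp p * t\<^sup>2" .
  have "\<bar>x + y\<bar> = \<bar>x\<bar> * (1 + t)"
    using t abs_mult[of x "1 + t"] by (simp add: y algebra_simps)
  then have "\<bar>x + y\<bar> powr p = \<bar>x\<bar> powr p * (1 + t) powr p" using t by (simp add: powr_mult)
  also have "\<dots> \<le> \<bar>x\<bar> powr p * (1 + p * t + p\<^sup>2 * exp p * t\<^sup>2)"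
    using * by (rule mult_left_mono) simp
  also have "\<dots> = \<bar>x\<bar> powr p + p * (\<bar>x\<bar> powr p * t) + p\<^sup>2 * exp p * (\<bar>x\<bar> powr p * t\<^sup>2)"
    by (simp add: algebra_simps)
  also have "\<bar>x\<bar> powr p * t = sgn x * \<bar>x\<bar> powr (p - 1) * y"
    using x by (simp add: y powr_diff sgn_if field_simps)
  also have "\<bar>x\<bar> powr p * t\<^sup>2 = \<bar>x\<bar> powr (p - 2) * \<bar>y\<bar> powr 2"
    using x by (simp add: y powr_diff power_mult_distrib field_simps)
  also have "\<bar>x\<bar> powr p + p * (sgn x * \<bar>x\<bar> powr (p - 1) * y)
        + p\<^sup>2 * exp p * (\<bar>x\<bar> powr (p - 2) * \<bar>y\<bar> powr 2)
      \<le> \<bar>x\<bar> powr p + p * (sgn x * \<bar>x\<bar> powr (p - 1) * y)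
        + taylor_const p * (\<bar>x\<bar> powr (p - 2) * \<bar>y\<bar> powr 2 + \<bar>y\<bar> powr p)"
    using p by (intro add_left_mono mult_mono) (auto simp: taylor_const_def)
  finally show ?thesis .
next
  case False
  have "\<bar>x + y\<bar> powr p \<le> (2 * \<bar>y\<bar>) powr p"
    using False p by (intro powr_mono2) auto
  then have 1: "\<bar>x + y\<bar> powr p \<le> 2 powr p * \<bar>y\<bar> powr p" by (simp add: powr_mult)
  have "\<bar>sgn x * \<bar>x\<bar> powr (p - 1) * y\<bar> \<le> \<bar>x\<bar> powr (p - 1) * \<bar>y\<bar>"
    by (auto simp: abs_mult sgn_if)
  also have "\<dots> \<le> \<bar>y\<bar> powr (p - 1) * \<bar>y\<bar>"
    using False p by (intro mult_right_mono powr_mono2) auto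
  also have "\<dots> = \<bar>y\<bar> powr p" by (cases "y = 0") (auto simp: powr_diff)
  finally have "- (sgn x * \<bar>x\<bar> powr (p - 1) * y) \<le> \<bar>y\<bar> powr p" by linarith
  then have 2: "p * - (sgn x * \<bar>x\<bar> powr (p - 1) * y) \<le> p * \<bar>y\<bar> powr p"
    using p by (intro mult_left_mono) auto
  have "(2 powr p + p) * \<bar>y\<bar> powr p
      \<le> taylor_const p * (\<bar>x\<bar> powr (p - 2) * \<bar>y\<bar> powr 2 + \<bar>y\<bar> powr p)"
    using p by (intro mult_mono) (auto simp: taylor_const_def)
  moreover have "0 \<le> \<bar>x\<bar> powr p" by simp
  ultimately show ?thesis using 1 2 by (simp only: distrib_right mult_minus_right)
qed

text \<open>Both \<open>s powr q + s powr (q - 1) * t\<close> and \<open>s powr q + t powr q\<close> are lower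
  bounds; the claim is their average.\<close>
lemma powr_add_ge:
  fixes s t q :: real
  assumes "s > 0" "t > 0" "q \<ge> 1"
  shows "s powr q + (s powr (q - 1) * t + t powr q) / 2 \<le> (s + t) powr q"
proof -
  have e: "u powr q = u * u powr (q - 1)" if "u > 0" for u
    using that by (simp add: powr_diff)
  have "s powr (q - 1) \<le> (s + t) powr (q - 1)" "t powr (q - 1) \<le> (s + t) powr (q - 1)"
    using assms by (auto intro!: powr_mono2)
  then have "s * s powr (q - 1) + (t * s powr (q - 1) + t * t powr (q - 1)) / 2
      \<le> s * (s + t) powr (q - 1) + (t * (s + t) powr (q - 1) + t * (s + t) powr (q - 1)) / 2"
    using assms by (intro add_mono divide_right_mono mult_left_mono) auto
  also have "\<dots> = (s + t) powr q"
    using e[of "s + t"] assms by (simp add: algebra_simps)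
  finally show ?thesis using e[of s] e[of t] assms by (simp add: mult.commute)
qed

text \<open>The induction step of the martingale inequality in numbers: \<open>4 * C * s\<close> is the bound so far
  for the squared norm, \<open>b\<close> bounds the norm of the new difference, and the left-hand side is
  the bound that \<open>moment_add_martingale_difference\<close> gives for the new moment. The factor \<open>4 * C\<close>
  is large enough for the two error terms to fit below the two halved terms of \<open>powr_add_ge\<close>.\<close>
lemma moment_recursion_step:
  fixes s b p C :: real
  assumes "s > 0" "b > 0" "p \<ge> 2" "C \<ge> 1"
  shows "(4 * C * s) powr (p / 2) + C * (2 * (4 * C * s) powr ((p - 2) / 2) * b powr 2 + b powr p)
           \<le> (4 * C * (s + b\<^sup>2)) powr (p / 2)"
proof -
  define q where "q = p / 2"
  define K where "K = 4 * C"
  have q: "q \<ge> 1" "p = 2 * q" "(p - 2) / 2 = q - 1" and K: "K > 0" "C = K / 4" "K \<ge> 4"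
    using assms by (auto simp: q_def K_def)
  have Kq: "K \<le> K powr q" using powr_mono[of 1 q K] K q by simp
  have "C * b powr p \<le> K powr q / 2 * (b\<^sup>2) powr q"
    using Kq K assms q by (intro mult_mono) (auto simp: powr_powr simp flip: powr_numeral)
  moreover have "C * (2 * (K * s) powr (q - 1) * b powr 2) = K powr q / 2 * (s powr (q - 1) * b\<^sup>2)"
    using K(1) assms by (simp add: K(2) powr_mult powr_diff)
  moreover have "(K * s) powr q = K powr q * s powr q" using K assms by (simp add: powr_mult)
  moreover have "K powr q * (s powr q + (s powr (q - 1) * b\<^sup>2 + (b\<^sup>2) powr q) / 2)
      = K powr q * s powr q + (K powr q / 2 * (s powr (q - 1) * b\<^sup>2) + K powr q / 2 * (b\<^sup>2) powr q)"
    by (simp add: algebra_simps)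
  ultimately have "(K * s) powr q + C * (2 * (K * s) powr (q - 1) * b powr 2 + b powr p)
      \<le> K powr q * (s powr q + (s powr (q - 1) * b\<^sup>2 + (b\<^sup>2) powr q) / 2)"
    by (simp only: distrib_left[of C])
  also have "\<dots> \<le> K powr q * (s + b\<^sup>2) powr q"
    using powr_add_ge[of s "b\<^sup>2" q] assms q by (intro mult_left_mono) auto
  also have "\<dots> = (K * (s + b\<^sup>2)) powr q" using K assms by (simp add: powr_mult)
  finally show ?thesis by (simp only: K_def q(3) q_def[symmetric])
qed

section \<open>Moments of sums\<close>

lemma integrable_abs_powr_add:
  fixes X Y :: "'a \<Rightarrow> real"
  assumes [measurable]: "X \<in> borel_measurable N" "Y \<in> borel_measurable N"
    and "integrable N (\<lambda>x. \<bar>X x\<bar> powr p)" "integrable N (\<lambda>x. \<bar>Y x\<bar> powr p)" "p > 0"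
  shows "integrable N (\<lambda>x. \<bar>X x + Y x\<bar> powr p)"
  by (rule Bochner_Integration.integrable_bound[where f="\<lambda>x. 2 powr p * (\<bar>X x\<bar> powr p + \<bar>Y x\<bar> powr p)"])
     (use assms abs_add_powr_le[of p] in \<open>auto simp: abs_mult\<close>)

lemma integrable_sgn_powr_mult:
  fixes X Y :: "'a \<Rightarrow> real"
  assumes [measurable]: "X \<in> borel_measurable N" "Y \<in> borel_measurable N"
    and "integrable N (\<lambda>x. \<bar>X x\<bar> powr p)" "integrable N (\<lambda>x. \<bar>Y x\<bar> powr p)" "p \<ge> 1"
  shows "integrable N (\<lambda>x. sgn (X x) * \<bar>X x\<bar> powr (p - 1) * Y x)"
proof (rule Bochner_Integration.integrable_bound[where f="\<lambda>x. \<bar>X x\<bar> powr p + \<bar>Y x\<bar> powr p"])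
  have "\<bar>sgn (X x) * \<bar>X x\<bar> powr (p - 1) * Y x\<bar> \<le> \<bar>X x\<bar> powr p + \<bar>Y x\<bar> powr p" for x
    using powr_mult_powr_le[of "p - 1" 1 "\<bar>X x\<bar>" "\<bar>Y x\<bar>"] assms(5) by (auto simp: abs_mult sgn_if)
  then show "AE x in N. norm (sgn (X x) * \<bar>X x\<bar> powr (p - 1) * Y x) \<le> norm (\<bar>X x\<bar> powr p + \<bar>Y x\<bar> powr p)"
    by (intro AE_I2) (smt (verit) real_norm_def)
qed (use assms in auto)

text \<open>The assumption \<open>orth\<close> is what remains of the martingale property: the linear term of the
  expansion of \<open>\<bar>X + Y\<bar> powr p\<close> vanishes in the mean.\<close>
lemma moment_add_martingale_difference:
  fixes X Y :: "'a \<Rightarrow> real"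
  assumes [measurable]: "X \<in> borel_measurable N" "Y \<in> borel_measurable N"
    and X: "integrable N (\<lambda>x. \<bar>X x\<bar> powr p)" "(\<integral>x. \<bar>X x\<bar> powr p \<partial>N) \<le> A powr p"
    and Y: "integrable N (\<lambda>x. \<bar>Y x\<bar> powr p)" "(\<integral>x. \<bar>Y x\<bar> powr p \<partial>N) \<le> b powr p"
    and orth: "(\<integral>x. sgn (X x) * \<bar>X x\<bar> powr (p - 1) * Y x \<partial>N) = 0"
    and p: "p \<ge> 2" and A: "A > 0" and b: "b > 0"
  shows "(\<integral>x. \<bar>X x + Y x\<bar> powr p \<partial>N)
           \<le> A powr p + taylor_const p * (2 * A powr (p - 2) * b powr 2 + b powr p)"
proof -
  let ?C = "taylor_const p"
  \<comment> \<open>Hoelder's inequality for the mixed moment, up to the factor 2: both factors are divided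
    by the bounds \<open>A\<close> and \<open>b\<close> on their norms before the pointwise inequality is applied.\<close>
  have mixed: "\<bar>X x\<bar> powr (p - 2) * \<bar>Y x\<bar> powr 2
      \<le> A powr (p - 2) * b powr 2 * (\<bar>X x\<bar> powr p / A powr p + \<bar>Y x\<bar> powr p / b powr p)" for x
  proof -
    have "(\<bar>X x\<bar> / A) powr (p - 2) * (\<bar>Y x\<bar> / b) powr 2
        \<le> (\<bar>X x\<bar> / A) powr p + (\<bar>Y x\<bar> / b) powr p"
      using powr_mult_powr_le[of "p - 2" 2 "\<bar>X x\<bar> / A" "\<bar>Y x\<bar> / b"] p A b by simp
    then have "A powr (p - 2) * b powr 2 * ((\<bar>X x\<bar> / A) powr (p - 2) * (\<bar>Y x\<bar> / b) powr 2)
        \<le> A powr (p - 2) * b powr 2 * ((\<bar>X x\<bar> / A) powr p + (\<bar>Y x\<bar> / b) powr p)"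
      by (rule mult_left_mono) simp
    then show ?thesis using A b by (simp add: powr_divide del: powr_numeral)
  qed
  have imixed: "integrable N (\<lambda>x. \<bar>X x\<bar> powr (p - 2) * \<bar>Y x\<bar> powr 2)"
    by (rule Bochner_Integration.integrable_bound[OF _ _ AE_I2,
          where f="\<lambda>x. A powr (p - 2) * b powr 2 * (\<bar>X x\<bar> powr p / A powr p + \<bar>Y x\<bar> powr p / b powr p)"])
       (use X Y mixed in \<open>auto simp del: powr_numeral\<close>)
  have "(\<integral>x. \<bar>X x\<bar> powr (p - 2) * \<bar>Y x\<bar> powr 2 \<partial>N)
      \<le> (\<integral>x. A powr (p - 2) * b powr 2 * (\<bar>X x\<bar> powr p / A powr p + \<bar>Y x\<bar> powr p / b powr p) \<partial>N)"
    by (rule integral_mono[OF imixed]) (use X Y mixed in auto)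
  also have "\<dots> = A powr (p - 2) * b powr 2 *
      ((\<integral>x. \<bar>X x\<bar> powr p \<partial>N) / A powr p + (\<integral>x. \<bar>Y x\<bar> powr p \<partial>N) / b powr p)"
    using X Y by simp
  also have "\<dots> \<le> A powr (p - 2) * b powr 2 * (1 + 1)"
    using X Y A b by (intro mult_left_mono add_mono) (auto simp: divide_le_eq)
  finally have m: "(\<integral>x. \<bar>X x\<bar> powr (p - 2) * \<bar>Y x\<bar> powr 2 \<partial>N) \<le> 2 * A powr (p - 2) * b powr 2"
    by simp
  have io: "integrable N (\<lambda>x. sgn (X x) * \<bar>X x\<bar> powr (p - 1) * Y x)"
    using X Y p by (intro integrable_sgn_powr_mult) auto
  have "(\<integral>x. \<bar>X x + Y x\<bar> powr p \<partial>N)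
      \<le> (\<integral>x. \<bar>X x\<bar> powr p + p * (sgn (X x) * \<bar>X x\<bar> powr (p - 1) * Y x)
           + ?C * (\<bar>X x\<bar> powr (p - 2) * \<bar>Y x\<bar> powr 2 + \<bar>Y x\<bar> powr p) \<partial>N)"
    using X Y p imixed io
    by (intro integral_mono abs_add_powr_expand integrable_abs_powr_add Bochner_Integration.integrable_add
          integrable_mult_right) auto
  also have "\<dots> = (\<integral>x. \<bar>X x\<bar> powr p \<partial>N) + p * (\<integral>x. sgn (X x) * \<bar>X x\<bar> powr (p - 1) * Y x \<partial>N)
           + ?C * ((\<integral>x. \<bar>X x\<bar> powr (p - 2) * \<bar>Y x\<bar> powr 2 \<partial>N) + (\<integral>x. \<bar>Y x\<bar> powr p \<partial>N))"
    using X Y imixed io by (simp del: powr_numeral)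
  also have "\<dots> \<le> A powr p + ?C * (2 * A powr (p - 2) * b powr 2 + b powr p)"
    unfolding orth using X Y m taylor_const_ge_1[of p] p
    by (auto intro!: add_mono mult_left_mono simp del: powr_numeral)
  finally show ?thesis .
qed

text \<open>This passes between norms and moments; it covers infinite moments as well, since then both sides
  are false.\<close>
lemma moment_norm_le_iff:
  assumes "p > 0" "c \<ge> 0"
  shows "moment_norm P p X \<le> ennreal c \<longleftrightarrow> (\<integral>\<^sup>+ \<omega>. ennreal (\<bar>X \<omega>\<bar> powr p) \<partial>P) \<le> ennreal (c powr p)"
proof (cases "\<integral>\<^sup>+ \<omega>. ennreal (\<bar>X \<omega>\<bar> powr p) \<partial>P" rule: ennreal_cases)
  case (real r)
  have "r powr (1 / p) \<le> c \<longleftrightarrow> (r powr (1 / p)) powr p \<le> c powr p"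
    using assms by (metis powr_ge_zero powr_less_mono2 not_less powr_mono2 less_imp_le)
  also have "(r powr (1 / p)) powr p = r" using assms real(1) by (simp add: powr_powr)
  finally show ?thesis using real assms by (simp add: moment_norm_def)
next
  case top
  then show ?thesis by (simp add: moment_norm_def top_unique)
qed

text \<open>Minkowski's inequality. With \<open>W = (\<Sum>s\<in>T. \<bar>a s\<bar> * c s)\<close>, the sum divided by \<open>W\<close> is
  dominated by a convex combination of the normalised variables \<open>\<bar>Y s\<bar> / c s\<close>, whose moments
  are at most 1, and \<open>\<bar>x\<bar> powr p\<close> is convex.\<close>
lemma moment_linear_combination_le:
  fixes Y :: "'s \<Rightarrow> 'a \<Rightarrow> real"
  assumes fin: "finite T" and p: "p \<ge> 1" and c: "\<And>s. s \<in> T \<Longrightarrow> c s > 0"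
    and [measurable]: "\<And>s. s \<in> T \<Longrightarrow> Y s \<in> borel_measurable N"
    and Y: "\<And>s. s \<in> T \<Longrightarrow> (\<integral>\<^sup>+ \<omega>. ennreal (\<bar>Y s \<omega>\<bar> powr p) \<partial>N) \<le> ennreal (c s powr p)"
  shows "(\<integral>\<^sup>+ \<omega>. ennreal (\<bar>\<Sum>s\<in>T. a s * Y s \<omega>\<bar> powr p) \<partial>N) \<le> ennreal ((\<Sum>s\<in>T. \<bar>a s\<bar> * c s) powr p)"
proof -
  define W where "W = (\<Sum>s\<in>T. \<bar>a s\<bar> * c s)"
  have nonneg: "\<bar>a s\<bar> * c s \<ge> 0" if "s \<in> T" for s using c[OF that] by simp
  then have W0: "W \<ge> 0" by (auto simp: W_def intro!: sum_nonneg)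
  show ?thesis
  proof (cases "W = 0")
    case True
    then have "\<forall>s\<in>T. \<bar>a s\<bar> * c s = 0"
      unfolding W_def using fin nonneg by (subst (asm) sum_nonneg_eq_0_iff) auto
    then have "\<forall>s\<in>T. a s = 0" using c by force
    then show ?thesis using p by simp
  next
    case False
    then have W: "W > 0" using W0 by simp
    define w where "w s = \<bar>a s\<bar> * c s / W" for s
    have w: "w s \<ge> 0" if "s \<in> T" for s using c[OF that] W by (simp add: w_def)
    have w1: "(\<Sum>s\<in>T. w s) = 1" using W by (simp add: w_def W_def flip: sum_divide_distrib)
    have ne: "T \<noteq> {}" using False by (auto simp: W_def)
    define v where "v s = W powr p * (w s / c s powr p)" for s
    have v: "v s \<ge> 0" if "s \<in> T" for s using w[OF that] by (simp add: v_def)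
    have "\<bar>\<Sum>s\<in>T. a s * Y s \<omega>\<bar> powr p \<le> (\<Sum>s\<in>T. v s * \<bar>Y s \<omega>\<bar> powr p)" for \<omega>
    proof -
      have "\<bar>\<Sum>s\<in>T. a s * Y s \<omega>\<bar> \<le> (\<Sum>s\<in>T. \<bar>a s * Y s \<omega>\<bar>)" by (rule sum_abs)
      also have "\<dots> = W * (\<Sum>s\<in>T. w s * (\<bar>Y s \<omega>\<bar> / c s))"
        unfolding sum_distrib_left using c W by (intro sum.cong) (force simp: w_def abs_mult)+
      finally have "\<bar>\<Sum>s\<in>T. a s * Y s \<omega>\<bar> powr p \<le> (W * (\<Sum>s\<in>T. w s * (\<bar>Y s \<omega>\<bar> / c s))) powr p"
        using p by (intro powr_mono2) auto
      also have "\<dots> = W powr p * \<bar>\<Sum>s\<in>T. w s * (\<bar>Y s \<omega>\<bar> / c s)\<bar> powr p"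
      proof -
        have "(\<Sum>s\<in>T. w s * (\<bar>Y s \<omega>\<bar> / c s)) \<ge> 0"
          using w c by (intro sum_nonneg mult_nonneg_nonneg divide_nonneg_pos) auto
        then show ?thesis using W0 by (simp add: powr_mult)
      qed
      also have "\<bar>\<Sum>s\<in>T. w s * (\<bar>Y s \<omega>\<bar> / c s)\<bar> powr p \<le> (\<Sum>s\<in>T. w s * \<bar>\<bar>Y s \<omega>\<bar> / c s\<bar> powr p)"
        using convex_on_sum[OF fin ne convex_on_abs_powr[OF p] w1 w, of "\<lambda>s. \<bar>Y s \<omega>\<bar> / c s"] by simp
      also have "W powr p * (\<Sum>s\<in>T. w s * \<bar>\<bar>Y s \<omega>\<bar> / c s\<bar> powr p) = (\<Sum>s\<in>T. v s * \<bar>Y s \<omega>\<bar> powr p)"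
        unfolding sum_distrib_left using c
        by (intro sum.cong refl) (simp add: v_def powr_divide less_imp_le abs_of_pos)
      finally show ?thesis by (simp add: mult_left_mono)
    qed
    then have "(\<integral>\<^sup>+ \<omega>. ennreal (\<bar>\<Sum>s\<in>T. a s * Y s \<omega>\<bar> powr p) \<partial>N)
        \<le> (\<integral>\<^sup>+ \<omega>. ennreal (\<Sum>s\<in>T. v s * \<bar>Y s \<omega>\<bar> powr p) \<partial>N)"
      by (intro nn_integral_mono ennreal_leI)
    also have "\<dots> = (\<integral>\<^sup>+ \<omega>. (\<Sum>s\<in>T. ennreal (v s) * ennreal (\<bar>Y s \<omega>\<bar> powr p)) \<partial>N)"
      using v by (intro nn_integral_cong) (simp add: sum_ennreal[symmetric] ennreal_mult)
    also have "\<dots> = (\<Sum>s\<in>T. ennreal (v s) * (\<integral>\<^sup>+ \<omega>. ennreal (\<bar>Y s \<omega>\<bar> powr p) \<partial>N))"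
      by (subst nn_integral_sum) (auto intro!: sum.cong nn_integral_cmult)
    also have "\<dots> \<le> (\<Sum>s\<in>T. ennreal (v s) * ennreal (c s powr p))"
      using Y by (intro sum_mono mult_left_mono) auto
    also have "\<dots> = (\<Sum>s\<in>T. ennreal (W powr p * w s))"
    proof (intro sum.cong refl)
      fix s assume s: "s \<in> T"
      show "ennreal (v s) * ennreal (c s powr p) = ennreal (W powr p * w s)"
        using v[OF s] c[OF s] by (simp add: v_def flip: ennreal_mult)
    qed
    also have "\<dots> = ennreal (\<Sum>s\<in>T. W powr p * w s)"
      using w by (intro sum_ennreal) auto
    also have "(\<Sum>s\<in>T. W powr p * w s) = W powr p" by (simp add: w1 flip: sum_distrib_left)
    finally show ?thesis by (simp add: W_def)
  qed
qed

section \<open>Convolution with a summable kernel on the plane lattice\<close>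

text \<open>Young's inequality for the convolution of \<open>l\<^sup>1\<close> with \<open>l\<^sup>2\<close>. The map \<open>\<phi>\<close> places
  the indices of \<open>a\<close> in the group.\<close>
lemma convolution_square_sum_le:
  fixes c :: "'g::ab_group_add \<Rightarrow> real" and a :: "'s \<Rightarrow> real" and \<phi> :: "'s \<Rightarrow> 'g"
  assumes fin: "finite T" "finite J" and c: "\<And>x. c x \<ge> 0"
    and D: "\<And>J. finite J \<Longrightarrow> (\<Sum>x\<in>J. c x) \<le> D" and inj: "inj_on \<phi> T"
  shows "(\<Sum>k\<in>J. (\<Sum>s\<in>T. \<bar>a s\<bar> * c (k - \<phi> s))\<^sup>2) \<le> D\<^sup>2 * (\<Sum>s\<in>T. (a s)\<^sup>2)"
proof -
  have D0: "D \<ge> 0" using D[of "{}"] by simp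
  have row: "(\<Sum>s\<in>T. c (k - \<phi> s)) \<le> D" for k
  proof -
    have "(\<Sum>s\<in>T. c (k - \<phi> s)) = sum c ((\<lambda>s. k - \<phi> s) ` T)"
      using inj by (subst sum.reindex) (auto simp: inj_on_def)
    also have "\<dots> \<le> D" using fin by (intro D) auto
    finally show ?thesis .
  qed
  have col: "(\<Sum>k\<in>J. c (k - x)) \<le> D" for x
  proof -
    have "(\<Sum>k\<in>J. c (k - x)) = sum c ((\<lambda>k. k - x) ` J)"
      by (subst sum.reindex) (auto simp: inj_on_def)
    also have "\<dots> \<le> D" using fin by (intro D) auto
    finally show ?thesis .
  qed
  have "(\<Sum>k\<in>J. (\<Sum>s\<in>T. \<bar>a s\<bar> * c (k - \<phi> s))\<^sup>2) \<le> (\<Sum>k\<in>J. D * (\<Sum>s\<in>T. (a s)\<^sup>2 * c (k - \<phi> s)))"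
  proof (rule sum_mono)
    fix k
    \<comment> \<open>Half of the kernel goes to each factor of the Cauchy-Schwarz inequality.\<close>
    have "(\<Sum>s\<in>T. \<bar>a s\<bar> * c (k - \<phi> s))\<^sup>2
        = (\<Sum>s\<in>T. sqrt (c (k - \<phi> s)) * (\<bar>a s\<bar> * sqrt (c (k - \<phi> s))))\<^sup>2"
      using c by (simp add: mult_ac flip: mult.assoc)
    also have "\<dots> \<le> (\<Sum>s\<in>T. (sqrt (c (k - \<phi> s)))\<^sup>2) * (\<Sum>s\<in>T. (\<bar>a s\<bar> * sqrt (c (k - \<phi> s)))\<^sup>2)"
      by (rule Cauchy_Schwarz_ineq_sum)
    also have "\<dots> = (\<Sum>s\<in>T. c (k - \<phi> s)) * (\<Sum>s\<in>T. (a s)\<^sup>2 * c (k - \<phi> s))"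
      using c by (simp add: power_mult_distrib)
    also have "\<dots> \<le> D * (\<Sum>s\<in>T. (a s)\<^sup>2 * c (k - \<phi> s))"
      using row c by (intro mult_right_mono sum_nonneg) auto
    finally show "(\<Sum>s\<in>T. \<bar>a s\<bar> * c (k - \<phi> s))\<^sup>2 \<le> D * (\<Sum>s\<in>T. (a s)\<^sup>2 * c (k - \<phi> s))" .
  qed
  also have "\<dots> = D * (\<Sum>s\<in>T. (a s)\<^sup>2 * (\<Sum>k\<in>J. c (k - \<phi> s)))"
    by (simp only: sum_distrib_left[symmetric]) (simp only: sum_distrib_left sum.swap[of _ J T])
  also have "\<dots> \<le> D * (\<Sum>s\<in>T. (a s)\<^sup>2 * D)"
    using col D0 by (intro mult_left_mono sum_mono) auto
  also have "\<dots> = D\<^sup>2 * (\<Sum>s\<in>T. (a s)\<^sup>2)"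
    by (simp add: power2_eq_square sum_distrib_left mult_ac)
  finally show ?thesis .
qed

lemma sum_int_powr_bounded:
  fixes \<gamma> :: real
  assumes "\<gamma> > 1"
  shows "\<exists>Z. \<forall>A. finite A \<longrightarrow> (\<Sum>p\<in>A. (1 + \<bar>real_of_int p\<bar>) powr - \<gamma>) \<le> Z"
proof -
  define f where "f n = (1 + real n) powr - \<gamma>" for n
  have "summable (\<lambda>n. real (Suc n) powr - \<gamma>)"
    using assms by (subst summable_Suc_iff) (simp add: summable_real_powr_iff)
  then have f: "summable f" by (simp add: f_def[abs_def] add.commute)
  have half: "(\<Sum>p\<in>A. (1 + \<bar>real_of_int p\<bar>) powr - \<gamma>) \<le> suminf f"
    if "finite A" "inj_on (\<lambda>p. nat \<bar>p\<bar>) A" for A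
  proof -
    have "(\<Sum>p\<in>A. (1 + \<bar>real_of_int p\<bar>) powr - \<gamma>) = (\<Sum>p\<in>A. f (nat \<bar>p\<bar>))"
      by (intro sum.cong) (auto simp: f_def)
    also have "\<dots> = sum f ((\<lambda>p. nat \<bar>p\<bar>) ` A)" using that by (subst sum.reindex) auto
    also have "\<dots> \<le> suminf f" using that f by (intro sum_le_suminf) (auto simp: f_def)
    finally show ?thesis .
  qed
  have "(\<Sum>p\<in>A. (1 + \<bar>real_of_int p\<bar>) powr - \<gamma>) \<le> 2 * suminf f" if A: "finite A" for A
  proof -
    have "(\<Sum>p\<in>A. (1 + \<bar>real_of_int p\<bar>) powr - \<gamma>)
        = (\<Sum>p\<in>A \<inter> {0..}. (1 + \<bar>real_of_int p\<bar>) powr - \<gamma>) + (\<Sum>p\<in>A - {0..}. (1 + \<bar>real_of_int p\<bar>) powr - \<gamma>)"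
      by (rule sum.Int_Diff[OF A])
    also have "\<dots> \<le> suminf f + suminf f"
      using A by (intro add_mono half) (auto simp: inj_on_def)
    finally show ?thesis by simp
  qed
  then show ?thesis by blast
qed

text \<open>Since \<open>(1 + \<bar>p\<bar> + \<bar>q\<bar>)\<^sup>2 \<ge> (1 + \<bar>p\<bar>) * (1 + \<bar>q\<bar>)\<close>, the summand is at most a
  product of two one-dimensional summands with exponent \<open>\<alpha> / 2 > 1\<close>.\<close>
lemma sum_lattice_powr_bounded:
  fixes \<alpha> :: real
  assumes "\<alpha> > 2"
  shows "\<exists>D. \<forall>J. finite J \<longrightarrow>
    (\<Sum>x\<in>J. (1 + \<bar>real_of_int (fst x)\<bar> + \<bar>real_of_int (snd x)\<bar>) powr - \<alpha>) \<le> D"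
proof -
  define w where "w p = (1 + \<bar>real_of_int p\<bar>) powr - (\<alpha> / 2)" for p
  obtain Z where Z: "\<And>A. finite A \<Longrightarrow> sum w A \<le> Z"
    using sum_int_powr_bounded[of "\<alpha> / 2"] assms unfolding w_def by auto
  have "(\<Sum>x\<in>J. (1 + \<bar>real_of_int (fst x)\<bar> + \<bar>real_of_int (snd x)\<bar>) powr - \<alpha>) \<le> Z * Z" if J: "finite J" for J
  proof -
    have "(\<Sum>x\<in>J. (1 + \<bar>real_of_int (fst x)\<bar> + \<bar>real_of_int (snd x)\<bar>) powr - \<alpha>) \<le> (\<Sum>x\<in>J. w (fst x) * w (snd x))"
    proof (rule sum_mono)
      fix x :: "int \<times> int"
      let ?a = "\<bar>real_of_int (fst x)\<bar>" and ?b = "\<bar>real_of_int (snd x)\<bar>"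
      have "(1 + ?a + ?b) powr - \<alpha> = (1 + ?a + ?b) powr - (\<alpha> / 2) * (1 + ?a + ?b) powr - (\<alpha> / 2)"
        by (simp flip: powr_add)
      also have "\<dots> \<le> w (fst x) * w (snd x)"
        unfolding w_def using assms by (intro mult_mono powr_mono2') auto
      finally show "(1 + ?a + ?b) powr - \<alpha> \<le> w (fst x) * w (snd x)" .
    qed
    also have "\<dots> \<le> (\<Sum>x\<in>fst ` J \<times> snd ` J. w (fst x) * w (snd x))"
      using J by (intro sum_mono2) (force simp: w_def)+
    also have "\<dots> = sum w (fst ` J) * sum w (snd ` J)"
      by (simp add: sum_product sum.cartesian_product split_beta')
    also have "\<dots> \<le> Z * Z"
      using J Z[of "{}"] by (intro mult_mono Z sum_nonneg) (auto simp: w_def)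
    finally show ?thesis .
  qed
  then show ?thesis by blast
qed

section \<open>Exchanging coordinates between two points of a product space\<close>

text \<open>The measure \<open>\<mu>\<close> below is the joint law of independent variables indexed by an arbitrary type.
  Its square \<open>\<mu> \<Otimes>\<^sub>M \<mu>\<close> is the law of these variables together with an independent copy. The
  product \<open>\<Pi>\<mu>\<close> over two copies of the index type represents the same law with all coordinates
  on an equal footing.\<close>
locale independent_coordinates = product_prob_space M UNIV for M :: "'i \<Rightarrow> 'b measure"
begin

abbreviation \<mu> where "\<mu> \<equiv> PiM UNIV M"

abbreviation \<Pi>\<mu> where "\<Pi>\<mu> \<equiv> PiM UNIV (case_sum M M :: 'i + 'i \<Rightarrow> 'b measure)"

sublocale \<mu>\<mu>: pair_prob_space \<mu> \<mu> ..

lemma case_sum_measurable: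
  "(\<lambda>(x, y). case_sum x y) \<in> \<mu> \<Otimes>\<^sub>M \<mu> \<rightarrow>\<^sub>M \<Pi>\<mu>"
proof (rule measurable_PiM_single')
  fix k :: "'i + 'i"
  show "(\<lambda>z. (case z of (x, y) \<Rightarrow> case_sum x y) k) \<in> \<mu> \<Otimes>\<^sub>M \<mu> \<rightarrow>\<^sub>M case_sum M M k"
    by (cases k) (auto simp: split_beta')
qed (auto simp: space_pair_measure space_PiM PiE_iff split: sum.split)

lemma split_measurable:
  "(\<lambda>z. (\<lambda>i. z (Inl i), \<lambda>i. z (Inr i))) \<in> \<Pi>\<mu> \<rightarrow>\<^sub>M \<mu> \<Otimes>\<^sub>M \<mu>"
proof -
  have "(\<lambda>z. z k) \<in> \<Pi>\<mu> \<rightarrow>\<^sub>M case_sum M M k" for k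
    by (rule measurable_component_singleton) simp
  from this[of "Inl i" for i] this[of "Inr i" for i]
  have m: "(\<lambda>z. z (Inl i)) \<in> \<Pi>\<mu> \<rightarrow>\<^sub>M M i" "(\<lambda>z. z (Inr i)) \<in> \<Pi>\<mu> \<rightarrow>\<^sub>M M i" for i
    by simp_all
  show ?thesis
    by (intro measurable_Pair measurable_PiM_single' m)
       (auto simp: PiE_iff intro: m[THEN measurable_space])
qed

text \<open>A measure on a product is determined by its values on boxes that restrict finitely many
  coordinates; on a box both sides are the same product of factors, grouped by the two copies.\<close>
lemma distr_case_sum: "distr (\<mu> \<Otimes>\<^sub>M \<mu>) \<Pi>\<mu> (\<lambda>(x, y). case_sum x y) = \<Pi>\<mu>" (is "?D = _")
proof (rule measure_eqI_PiM_infinite[symmetric, OF refl])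
  have ps: "prob_space (case_sum M M i)" for i by (cases i) (auto simp: prob_space)
  interpret \<Pi>: prob_space \<Pi>\<mu>
    using ps by (intro prob_space_PiM) auto
  show "finite_measure \<Pi>\<mu>" by unfold_locales
  fix A and J :: "('i + 'i) set"
  assume J: "finite J" and A: "\<And>i. i \<in> J \<Longrightarrow> A i \<in> sets (case_sum M M i)"
  define J1 where "J1 = Inl -` J"
  define J2 where "J2 = Inr -` J"
  have J12: "J = J1 <+> J2" unfolding J1_def J2_def
    by (auto simp: image_iff) (metis Inl_Inr_False old.sum.exhaust Plus_def UnI1 UnI2 image_eqI vimage_eq)
  have fin: "finite J1" "finite J2" using J by (auto simp: J1_def J2_def intro!: finite_vimageI)
  have A1: "A (Inl i) \<in> sets (M i)" if "i \<in> J1" for i using A[of "Inl i"] that by (simp add: J1_def)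
  have A2: "A (Inr i) \<in> sets (M i)" if "i \<in> J2" for i using A[of "Inr i"] that by (simp add: J2_def)
  let ?X = "prod_emb UNIV (case_sum M M) J (Pi\<^sub>E J A)"
  let ?X1 = "prod_emb UNIV M J1 (\<Pi>\<^sub>E i\<in>J1. A (Inl i))"
  let ?X2 = "prod_emb UNIV M J2 (\<Pi>\<^sub>E i\<in>J2. A (Inr i))"
  have "\<Pi>\<mu> ?X = (\<Prod>i\<in>J. emeasure (case_sum M M i) (A i))"
    using J A ps by (intro Infinite_Product_Measure.emeasure_PiM_emb) auto
  also have "\<dots> = (\<Prod>i\<in>J1. emeasure (M i) (A (Inl i))) * (\<Prod>i\<in>J2. emeasure (M i) (A (Inr i)))"
    unfolding J12 using fin by (simp add: prod.Plus)
  also have "\<dots> = emeasure \<mu> ?X1 * emeasure \<mu> ?X2"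
    using fin A1 A2 by (simp add: emeasure_PiM_emb)
  also have "\<dots> = emeasure (\<mu> \<Otimes>\<^sub>M \<mu>) (?X1 \<times> ?X2)"
    using fin A1 A2 by (intro P.emeasure_pair_measure_Times[symmetric] sets_PiM_I) auto
  also have "?X1 \<times> ?X2 = (\<lambda>(x, y). case_sum x y) -` ?X \<inter> space (\<mu> \<Otimes>\<^sub>M \<mu>)"
    unfolding J12 Plus_def
    by (auto simp: prod_emb_def space_pair_measure space_PiM PiE_iff ball_Un split: sum.splits)
  also have "emeasure (\<mu> \<Otimes>\<^sub>M \<mu>) \<dots> = emeasure ?D ?X"
    using J A by (intro emeasure_distr[symmetric] case_sum_measurable sets_PiM_I) auto
  finally show "emeasure \<Pi>\<mu> ?X = emeasure ?D ?X" .
qed simp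

lemma distr_split: "distr \<Pi>\<mu> (\<mu> \<Otimes>\<^sub>M \<mu>) (\<lambda>z. (\<lambda>i. z (Inl i), \<lambda>i. z (Inr i))) = \<mu> \<Otimes>\<^sub>M \<mu>"
proof -
  have "distr \<Pi>\<mu> (\<mu> \<Otimes>\<^sub>M \<mu>) (\<lambda>z. (\<lambda>i. z (Inl i), \<lambda>i. z (Inr i)))
      = distr (distr (\<mu> \<Otimes>\<^sub>M \<mu>) \<Pi>\<mu> (\<lambda>(x, y). case_sum x y)) (\<mu> \<Otimes>\<^sub>M \<mu>) (\<lambda>z. (\<lambda>i. z (Inl i), \<lambda>i. z (Inr i)))"
    by (simp add: distr_case_sum)
  also have "\<dots> = distr (\<mu> \<Otimes>\<^sub>M \<mu>) (\<mu> \<Otimes>\<^sub>M \<mu>) (\<lambda>z. z)"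
    by (subst distr_distr[OF split_measurable case_sum_measurable]) (auto simp: comp_def split_beta')
  finally show ?thesis by simp
qed

definition mix :: "'i set \<Rightarrow> ('i \<Rightarrow> 'b) \<Rightarrow> ('i \<Rightarrow> 'b) \<Rightarrow> 'i \<Rightarrow> 'b" where
  "mix J x y = (\<lambda>i. if i \<in> J then x i else y i)"

definition exchange_off :: "'i set \<Rightarrow> ('i \<Rightarrow> 'b) \<times> ('i \<Rightarrow> 'b) \<Rightarrow> ('i \<Rightarrow> 'b) \<times> ('i \<Rightarrow> 'b)" where
  "exchange_off J = (\<lambda>(x, y). (mix J x y, mix J y x))"

lemma mix_measurable: "(\<lambda>(x, y). mix J x y) \<in> \<mu> \<Otimes>\<^sub>M \<mu> \<rightarrow>\<^sub>M \<mu>"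
proof (rule measurable_PiM_single')
  show "(\<lambda>z. (case z of (x, y) \<Rightarrow> mix J x y) i) \<in> \<mu> \<Otimes>\<^sub>M \<mu> \<rightarrow>\<^sub>M M i" for i
    by (cases "i \<in> J") (auto simp: mix_def split_beta')
qed (auto simp: mix_def space_pair_measure space_PiM PiE_iff)

lemma exchange_off_measurable: "exchange_off J \<in> \<mu> \<Otimes>\<^sub>M \<mu> \<rightarrow>\<^sub>M \<mu> \<Otimes>\<^sub>M \<mu>"
proof -
  have "(\<lambda>z. (\<lambda>(x, y). mix J x y) (snd z, fst z)) \<in> \<mu> \<Otimes>\<^sub>M \<mu> \<rightarrow>\<^sub>M \<mu>"
    by (rule measurable_compose[OF _ mix_measurable]) simp
  then show ?thesis
    using mix_measurable[of J] unfolding exchange_off_def split_beta'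
    by (intro measurable_Pair) (simp_all add: split_beta')
qed

text \<open>Seen on \<open>\<Pi>\<mu>\<close>, the map is the permutation of coordinates that exchanges the two copies of
  each index outside \<open>J\<close>. Exchanged coordinates have the same law, and a product measure is
  invariant under such a permutation.\<close>
lemma distr_exchange_off: "distr (\<mu> \<Otimes>\<^sub>M \<mu>) (\<mu> \<Otimes>\<^sub>M \<mu>) (exchange_off J) = \<mu> \<Otimes>\<^sub>M \<mu>"
proof -
  define f :: "'i + 'i \<Rightarrow> 'i + 'i" where
    "f = case_sum (\<lambda>i. if i \<in> J then Inl i else Inr i) (\<lambda>i. if i \<in> J then Inr i else Inl i)"
  let ?spl = "\<lambda>z. (\<lambda>i. z (Inl i), \<lambda>i. z (Inr i))"
  have inj: "inj f" by (auto simp: inj_def f_def split: sum.splits if_splits)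
  have Mf: "case_sum M M (f k) = case_sum M M k" for k by (cases k) (auto simp: f_def)
  have ps: "prob_space (case_sum M M k)" for k by (cases k) (auto simp: prob_space)
  have perm: "distr \<Pi>\<mu> \<Pi>\<mu> (\<lambda>z k. z (f k)) = \<Pi>\<mu>"
    using distr_PiM_reindex[of UNIV "case_sum M M" f UNIV] inj ps by (simp add: Mf restrict_UNIV)
  have pm: "(\<lambda>z k. z (f k)) \<in> \<Pi>\<mu> \<rightarrow>\<^sub>M \<Pi>\<mu>"
  proof (rule measurable_PiM_single')
    show "(\<lambda>z. z (f k)) \<in> \<Pi>\<mu> \<rightarrow>\<^sub>M case_sum M M k" for k
      using measurable_component_singleton[of "f k" UNIV "case_sum M M"] by (simp add: Mf)
  qed (use Mf in \<open>auto simp: space_PiM PiE_iff, metis\<close>)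
  have "distr (\<mu> \<Otimes>\<^sub>M \<mu>) (\<mu> \<Otimes>\<^sub>M \<mu>) (exchange_off J)
      = distr \<Pi>\<mu> (\<mu> \<Otimes>\<^sub>M \<mu>) (exchange_off J \<circ> ?spl)"
    by (subst distr_split[symmetric]) (rule distr_distr[OF exchange_off_measurable split_measurable])
  also have "exchange_off J \<circ> ?spl = ?spl \<circ> (\<lambda>z k. z (f k))"
    by (auto simp: exchange_off_def mix_def f_def fun_eq_iff)
  also have "distr \<Pi>\<mu> (\<mu> \<Otimes>\<^sub>M \<mu>) (?spl \<circ> (\<lambda>z k. z (f k))) = distr (distr \<Pi>\<mu> \<Pi>\<mu> (\<lambda>z k. z (f k))) (\<mu> \<Otimes>\<^sub>M \<mu>) ?spl"
    by (rule distr_distr[OF split_measurable pm, symmetric])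
  also have "\<dots> = \<mu> \<Otimes>\<^sub>M \<mu>" by (simp add: perm distr_split)
  finally show ?thesis .
qed

end

section \<open>Averaging out coordinates\<close>

text \<open>Jensen's inequality in the second variable.\<close>
lemma (in pair_prob_space) integral_abs_powr_fst_le:
  fixes F :: "'a \<times> 'b \<Rightarrow> real"
  assumes F: "integrable (M1 \<Otimes>\<^sub>M M2) F" and Fp: "integrable (M1 \<Otimes>\<^sub>M M2) (\<lambda>z. \<bar>F z\<bar> powr p)"
    and p: "p \<ge> 1"
  shows "integrable M1 (\<lambda>x. \<bar>\<integral>y. F (x, y) \<partial>M2\<bar> powr p)"
    and "(\<integral>x. \<bar>\<integral>y. F (x, y) \<partial>M2\<bar> powr p \<partial>M1) \<le> (\<integral>z. \<bar>F z\<bar> powr p \<partial>(M1 \<Otimes>\<^sub>M M2))"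
proof -
  have *: "AE x in M1. \<bar>\<integral>y. F (x, y) \<partial>M2\<bar> powr p \<le> (\<integral>y. \<bar>F (x, y)\<bar> powr p \<partial>M2)"
    using AE_integrable_fst'[OF F] AE_integrable_fst'[OF Fp]
  proof eventually_elim
    case (elim x)
    then show ?case
      using M2.jensens_inequality[of "\<lambda>y. F (x, y)" UNIV 0 0 "\<lambda>t. \<bar>t\<bar> powr p"] convex_on_abs_powr[OF p]
      by simp
  qed
  have m: "(\<lambda>x. \<bar>\<integral>y. F (x, y) \<partial>M2\<bar> powr p) \<in> borel_measurable M1"
    using integrable_fst'[OF F] by measurable
  show 1: "integrable M1 (\<lambda>x. \<bar>\<integral>y. F (x, y) \<partial>M2\<bar> powr p)"
    by (rule Bochner_Integration.integrable_bound[OF integrable_fst'[OF Fp] m])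
       (use * in \<open>auto elim!: eventually_mono\<close>)
  have "(\<integral>x. \<bar>\<integral>y. F (x, y) \<partial>M2\<bar> powr p \<partial>M1) \<le> (\<integral>x. (\<integral>y. \<bar>F (x, y)\<bar> powr p \<partial>M2) \<partial>M1)"
    by (rule integral_mono_AE[OF 1 integrable_fst'[OF Fp] *])
  then show "(\<integral>x. \<bar>\<integral>y. F (x, y) \<partial>M2\<bar> powr p \<partial>M1) \<le> (\<integral>z. \<bar>F z\<bar> powr p \<partial>(M1 \<Otimes>\<^sub>M M2))"
    by (simp add: integral_fst'[OF Fp])
qed

context independent_coordinates
begin

lemma fst_exchange_off: "fst (exchange_off J z) = mix J (fst z) (snd z)"
  by (simp add: exchange_off_def split_beta')

lemma mix_space: "x \<in> space \<mu> \<Longrightarrow> y \<in> space \<mu> \<Longrightarrow> mix J x y \<in> space \<mu>"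
  by (auto simp: mix_def space_PiM PiE_iff)

lemma mix_comp_measurable:
  "f \<in> borel_measurable \<mu> \<Longrightarrow> (\<lambda>z. f (mix J (fst z) (snd z))) \<in> borel_measurable (\<mu> \<Otimes>\<^sub>M \<mu>)"
  using measurable_compose[OF mix_measurable[of J], of f borel] by (simp add: split_beta')

lemma integral_exchange_off:
  fixes f :: "_ \<Rightarrow> real"
  assumes "f \<in> borel_measurable (\<mu> \<Otimes>\<^sub>M \<mu>)"
  shows "(\<integral>z. f (exchange_off J z) \<partial>(\<mu> \<Otimes>\<^sub>M \<mu>)) = (\<integral>z. f z \<partial>(\<mu> \<Otimes>\<^sub>M \<mu>))"
  using integral_distr[OF exchange_off_measurable assms, of J] by (simp add: distr_exchange_off)

lemma integrable_exchange_off: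
  fixes f :: "_ \<Rightarrow> real"
  assumes "integrable (\<mu> \<Otimes>\<^sub>M \<mu>) f"
  shows "integrable (\<mu> \<Otimes>\<^sub>M \<mu>) (\<lambda>z. f (exchange_off J z))"
  using integrable_distr[OF exchange_off_measurable[of J], of f] assms by (simp add: distr_exchange_off)

lemma integrable_comp_fst:
  fixes f :: "_ \<Rightarrow> real"
  assumes "integrable \<mu> f"
  shows "integrable (\<mu> \<Otimes>\<^sub>M \<mu>) (\<lambda>z. f (fst z))"
  by (rule integrable_distr[OF measurable_fst]) (simp add: distr_pair_fst assms)

lemma integrable_mix:
  fixes f :: "_ \<Rightarrow> real"
  assumes "integrable \<mu> f"
  shows "integrable (\<mu> \<Otimes>\<^sub>M \<mu>) (\<lambda>z. f (mix J (fst z) (snd z)))"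
  using integrable_exchange_off[OF integrable_comp_fst[OF assms], of J] by (simp add: fst_exchange_off)

lemma integral_mix:
  fixes f :: "_ \<Rightarrow> real"
  assumes [measurable]: "f \<in> borel_measurable \<mu>"
  shows "(\<integral>z. f (mix J (fst z) (snd z)) \<partial>(\<mu> \<Otimes>\<^sub>M \<mu>)) = (\<integral>x. f x \<partial>\<mu>)"
proof -
  have "(\<integral>z. f (mix J (fst z) (snd z)) \<partial>(\<mu> \<Otimes>\<^sub>M \<mu>)) = (\<integral>z. f (fst z) \<partial>(\<mu> \<Otimes>\<^sub>M \<mu>))"
    using integral_exchange_off[of "\<lambda>z. f (fst z)" J] by (simp add: fst_exchange_off)
  also have "\<dots> = (\<integral>x. f x \<partial>distr (\<mu> \<Otimes>\<^sub>M \<mu>) \<mu> fst)" by (rule integral_distr[symmetric]) auto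
  finally show ?thesis by (simp add: distr_pair_fst)
qed

text \<open>Whether the coordinates outside \<open>J\<close> matter is tested by overwriting them. Restricting the
  test to points of the space lets indicator functions of measurable boxes qualify.\<close>
definition depends_on :: "'i set \<Rightarrow> (('i \<Rightarrow> 'b) \<Rightarrow> 'c) \<Rightarrow> bool" where
  "depends_on J h \<longleftrightarrow> (\<forall>x\<in>space \<mu>. \<forall>y\<in>space \<mu>. h (mix J x y) = h x)"

lemma depends_on_mono:
  assumes "depends_on J h" "J \<subseteq> J'"
  shows "depends_on J' h"
  unfolding depends_on_def
proof safe
  fix x y assume xy: "x \<in> space \<mu>" "y \<in> space \<mu>"
  have "h (mix J' x y) = h (mix J (mix J' x y) y)"
    using assms(1) xy mix_space by (auto simp: depends_on_def)
  also have "mix J (mix J' x y) y = mix J x y" using assms(2) by (auto simp: mix_def fun_eq_iff)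
  also have "h (mix J x y) = h x" using assms(1) xy by (auto simp: depends_on_def)
  finally show "h (mix J' x y) = h x" .
qed

text \<open>A version of the conditional expectation of \<open>g\<close> given the coordinates in \<open>J\<close>; for
  integrable \<open>g\<close> the integral over \<open>y\<close> exists for almost every \<open>x\<close>.\<close>
definition cond_avg :: "'i set \<Rightarrow> (('i \<Rightarrow> 'b) \<Rightarrow> real) \<Rightarrow> ('i \<Rightarrow> 'b) \<Rightarrow> real" where
  "cond_avg J g x = (\<integral>y. g (mix J x y) \<partial>\<mu>)"

lemma depends_on_cond_avg: "depends_on J (cond_avg J g)"
proof -
  have "mix J (mix J x y) z = mix J x z" for x y z :: "'i \<Rightarrow> 'b" by (auto simp: mix_def)
  then show ?thesis by (simp add: depends_on_def cond_avg_def)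
qed

lemma cond_avg_eq:
  assumes "depends_on J h" "x \<in> space \<mu>"
  shows "cond_avg J h x = h x"
proof -
  have "cond_avg J h x = (\<integral>y. h x \<partial>\<mu>)"
    unfolding cond_avg_def using assms by (intro Bochner_Integration.integral_cong) (auto simp: depends_on_def)
  then show ?thesis by (simp add: P.prob_space)
qed

lemma integrable_cond_avg:
  assumes "integrable \<mu> g"
  shows "integrable \<mu> (cond_avg J g)"
  using \<mu>\<mu>.integrable_fst'[OF integrable_mix[OF assms, of J]] by (simp add: cond_avg_def[abs_def])

lemma AE_integrable_mix:
  fixes g :: "_ \<Rightarrow> real"
  assumes "integrable \<mu> g"
  shows "AE x in \<mu>. integrable \<mu> (\<lambda>y. g (mix J x y))"
  using \<mu>\<mu>.AE_integrable_fst'[OF integrable_mix[OF assms, of J]] by simp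

lemma moment_cond_avg_le:
  assumes "integrable \<mu> g" "integrable \<mu> (\<lambda>x. \<bar>g x\<bar> powr p)" "p \<ge> 1"
  shows "integrable \<mu> (\<lambda>x. \<bar>cond_avg J g x\<bar> powr p)"
    and "(\<integral>x. \<bar>cond_avg J g x\<bar> powr p \<partial>\<mu>) \<le> (\<integral>x. \<bar>g x\<bar> powr p \<partial>\<mu>)"
  using \<mu>\<mu>.integral_abs_powr_fst_le[OF integrable_mix[OF assms(1), of J] integrable_mix[OF assms(2), of J] assms(3)]
    integral_mix[OF borel_measurable_integrable[OF assms(2)], of J]
  by (simp_all add: cond_avg_def)

text \<open>The defining property of a conditional expectation. If \<open>(x, y)\<close> has law \<open>\<mu> \<Otimes>\<^sub>M \<mu>\<close>, then
  \<open>mix J x y\<close> has law \<open>\<mu>\<close>, while \<open>h (mix J x y)\<close> does not depend on \<open>y\<close> and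
  leaves the inner integral.\<close>
lemma integral_mult_cond_avg:
  fixes h g :: "('i \<Rightarrow> 'b) \<Rightarrow> real"
  assumes h: "depends_on J h" and hg: "integrable \<mu> (\<lambda>x. h x * g x)"
  shows "(\<integral>x. h x * cond_avg J g x \<partial>\<mu>) = (\<integral>x. h x * g x \<partial>\<mu>)"
proof -
  have "(\<integral>x. h x * g x \<partial>\<mu>) = (\<integral>z. h (mix J (fst z) (snd z)) * g (mix J (fst z) (snd z)) \<partial>(\<mu> \<Otimes>\<^sub>M \<mu>))"
    by (rule integral_mix[OF borel_measurable_integrable[OF hg], symmetric])
  also have "\<dots> = (\<integral>x. (\<integral>y. h (mix J x y) * g (mix J x y) \<partial>\<mu>) \<partial>\<mu>)"
    using \<mu>\<mu>.integral_fst'[OF integrable_mix[OF hg, of J]] by simp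
  also have "\<dots> = (\<integral>x. (\<integral>y. h x * g (mix J x y) \<partial>\<mu>) \<partial>\<mu>)"
    using h by (intro Bochner_Integration.integral_cong refl) (auto simp: depends_on_def)
  finally show ?thesis by (simp add: cond_avg_def)
qed

text \<open>The redrawn point is \<open>(fst z)(k := snd z k)\<close>; written with \<open>mix\<close>, it falls under the
  lemmas on exchanged coordinates.\<close>
definition resampling_diff :: "'i \<Rightarrow> (('i \<Rightarrow> 'b) \<Rightarrow> real) \<Rightarrow> ('i \<Rightarrow> 'b) \<times> ('i \<Rightarrow> 'b) \<Rightarrow> real" where
  "resampling_diff k g z = g (fst z) - g (mix (- {k}) (fst z) (snd z))"

lemma mix_Compl_singleton: "mix (- {k}) x y = x(k := y k)"
  by (auto simp: mix_def)

text \<open>The points at which the two averages evaluate \<open>g\<close> differ only in coordinate \<open>k\<close>, where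
  the second one carries an independent value. Up to an exchange of coordinates outside
  \<open>insert k J\<close>, which keeps the joint law, they are a point of law \<open>\<mu>\<close> and the same point
  with coordinate \<open>k\<close> redrawn; Jensen's inequality removes the average.\<close>
lemma moment_cond_avg_increment:
  fixes g :: "('i \<Rightarrow> 'b) \<Rightarrow> real"
  assumes g: "integrable \<mu> g" and gp: "integrable \<mu> (\<lambda>x. \<bar>g x\<bar> powr p)" and p: "p \<ge> 1" and k: "k \<notin> J"
  shows "integrable \<mu> (\<lambda>x. \<bar>cond_avg (insert k J) g x - cond_avg J g x\<bar> powr p)"
    and "(\<integral>x. \<bar>cond_avg (insert k J) g x - cond_avg J g x\<bar> powr p \<partial>\<mu>)
           \<le> (\<integral>z. \<bar>resampling_diff k g z\<bar> powr p \<partial>(\<mu> \<Otimes>\<^sub>M \<mu>))"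
proof -
  let ?J = "insert k J"
  define F where "F z = g (mix ?J (fst z) (snd z)) - g (mix J (fst z) (snd z))" for z
  have [measurable]: "g \<in> borel_measurable \<mu>" using g by auto
  note [measurable] = mix_comp_measurable[of g]
  have F: "integrable (\<mu> \<Otimes>\<^sub>M \<mu>) F" unfolding F_def using g by (intro Bochner_Integration.integrable_diff integrable_mix)
  have Fp: "integrable (\<mu> \<Otimes>\<^sub>M \<mu>) (\<lambda>z. \<bar>F z\<bar> powr p)"
    using integrable_abs_powr_add[of "\<lambda>z. g (mix ?J (fst z) (snd z))" "\<mu> \<Otimes>\<^sub>M \<mu>"
        "\<lambda>z. - g (mix J (fst z) (snd z))" p] integrable_mix[OF gp] p by (simp add: F_def)
  have diff: "AE x in \<mu>. (\<integral>y. F (x, y) \<partial>\<mu>) = cond_avg ?J g x - cond_avg J g x"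
    using AE_integrable_mix[OF g, of ?J] AE_integrable_mix[OF g, of J]
    by eventually_elim (simp add: F_def cond_avg_def)
  have [measurable]: "cond_avg ?J g \<in> borel_measurable \<mu>" "cond_avg J g \<in> borel_measurable \<mu>"
    using integrable_cond_avg[OF g] by auto
  have [measurable]: "(\<lambda>x. \<integral>y. F (x, y) \<partial>\<mu>) \<in> borel_measurable \<mu>"
    using \<mu>\<mu>.integrable_fst'[OF F] by auto
  have diffp: "AE x in \<mu>. \<bar>\<integral>y. F (x, y) \<partial>\<mu>\<bar> powr p = \<bar>cond_avg ?J g x - cond_avg J g x\<bar> powr p"
    using diff by eventually_elim simp
  note * = \<mu>\<mu>.integral_abs_powr_fst_le[OF F Fp p]
  show "integrable \<mu> (\<lambda>x. \<bar>cond_avg ?J g x - cond_avg J g x\<bar> powr p)"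
    by (rule integrable_cong_AE_imp[OF *(1)]) (use diffp in auto)
  have "(\<integral>x. \<bar>cond_avg ?J g x - cond_avg J g x\<bar> powr p \<partial>\<mu>) = (\<integral>x. \<bar>\<integral>y. F (x, y) \<partial>\<mu>\<bar> powr p \<partial>\<mu>)"
    by (rule integral_cong_AE) (use diffp in auto)
  also have "\<dots> \<le> (\<integral>z. \<bar>F z\<bar> powr p \<partial>(\<mu> \<Otimes>\<^sub>M \<mu>))" by (rule *(2))
  also have "(\<lambda>z. \<bar>F z\<bar> powr p) = (\<lambda>z. \<bar>resampling_diff k g (exchange_off ?J z)\<bar> powr p)"
  proof
    fix z :: "('i \<Rightarrow> 'b) \<times> ('i \<Rightarrow> 'b)"
    have "mix (- {k}) (fst (exchange_off ?J z)) (snd (exchange_off ?J z)) = mix J (fst z) (snd z)"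
      using k by (auto simp: exchange_off_def mix_def split_beta')
    then show "\<bar>F z\<bar> powr p = \<bar>resampling_diff k g (exchange_off ?J z)\<bar> powr p"
      by (simp add: F_def resampling_diff_def fst_exchange_off)
  qed
  also have "(\<integral>z. \<bar>resampling_diff k g (exchange_off ?J z)\<bar> powr p \<partial>(\<mu> \<Otimes>\<^sub>M \<mu>))
      = (\<integral>z. \<bar>resampling_diff k g z\<bar> powr p \<partial>(\<mu> \<Otimes>\<^sub>M \<mu>))"
    by (rule integral_exchange_off) (simp add: resampling_diff_def)
  finally show "(\<integral>x. \<bar>cond_avg ?J g x - cond_avg J g x\<bar> powr p \<partial>\<mu>)
           \<le> (\<integral>z. \<bar>resampling_diff k g z\<bar> powr p \<partial>(\<mu> \<Otimes>\<^sub>M \<mu>))" .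
qed

text \<open>The martingale inequality for finitely many revealed coordinates. The positive \<open>\<beta>\<close> keeps the
  bound positive at the start, where no coordinate is revealed and the average is zero; the
  estimate of the mixed moment divides by the bound.\<close>
lemma moment_cond_avg_finite:
  fixes g :: "('i \<Rightarrow> 'b) \<Rightarrow> real"
  assumes g: "integrable \<mu> g" "(\<integral>x. g x \<partial>\<mu>) = 0" and gp: "integrable \<mu> (\<lambda>x. \<bar>g x\<bar> powr p)"
    and p: "p \<ge> 2" and b: "\<And>k. b k > 0"
    and res: "\<And>k. (\<integral>z. \<bar>resampling_diff k g z\<bar> powr p \<partial>(\<mu> \<Otimes>\<^sub>M \<mu>)) \<le> b k powr p"
    and \<beta>: "\<beta> > 0" and J: "finite J"
  shows "(\<integral>x. \<bar>cond_avg J g x\<bar> powr p \<partial>\<mu>) \<le> (4 * taylor_const p * (\<beta> + (\<Sum>k\<in>J. (b k)\<^sup>2))) powr (p / 2)"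
  using J
proof (induction J rule: finite_induct)
  case empty
  have "cond_avg {} g x = 0" for x using g(2) by (simp add: cond_avg_def mix_def)
  then show ?case using p by simp
next
  case (insert k J)
  let ?C = "taylor_const p"
  define s where "s = \<beta> + (\<Sum>k\<in>J. (b k)\<^sup>2)"
  have s: "s > 0" using \<beta> by (auto simp: s_def intro!: add_pos_nonneg sum_nonneg)
  have C: "?C \<ge> 1" using taylor_const_ge_1[of p] p by simp
  define A where "A = sqrt (4 * ?C * s)"
  have A: "A > 0" using s C by (simp add: A_def)
  have Ap: "A powr r = (4 * ?C * s) powr (r / 2)" for r
    using s C by (simp add: A_def powr_half_sqrt[symmetric] powr_powr)
  define X where "X = cond_avg J g"
  define Y where "Y x = cond_avg (insert k J) g x - cond_avg J g x" for x
  have mX: "X \<in> borel_measurable \<mu>" and mY: "Y \<in> borel_measurable \<mu>"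
    using integrable_cond_avg[OF g(1)] by (auto simp: X_def Y_def[abs_def])
  note [measurable] = mX mY
  have X: "integrable \<mu> (\<lambda>x. \<bar>X x\<bar> powr p)" and X': "integrable \<mu> (\<lambda>x. \<bar>cond_avg (insert k J) g x\<bar> powr p)"
    unfolding X_def using g gp p by (auto intro!: moment_cond_avg_le)
  have Y: "integrable \<mu> (\<lambda>x. \<bar>Y x\<bar> powr p)" "(\<integral>x. \<bar>Y x\<bar> powr p \<partial>\<mu>) \<le> b k powr p"
    using moment_cond_avg_increment[OF g(1) gp _ insert.hyps(2)] p order_trans[OF _ res]
    by (auto simp: Y_def)
  define h where "h x = sgn (X x) * \<bar>X x\<bar> powr (p - 1)" for x
  have h: "depends_on J h"
    using depends_on_cond_avg[of J g] by (simp add: depends_on_def h_def X_def)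
  have ih: "integrable \<mu> (\<lambda>x. h x * g x)" "integrable \<mu> (\<lambda>x. h x * X x)"
    "integrable \<mu> (\<lambda>x. h x * cond_avg (insert k J) g x)"
    unfolding h_def using g gp X X' p integrable_cond_avg[OF g(1)]
    by (auto intro!: integrable_sgn_powr_mult)
  \<comment> \<open>Both averages have the same integral against \<open>h\<close> as \<open>g\<close> itself, because \<open>h\<close> depends on the
    coordinates in \<open>J\<close> only.\<close>
  have "(\<integral>x. h x * Y x \<partial>\<mu>) = (\<integral>x. h x * cond_avg (insert k J) g x \<partial>\<mu>) - (\<integral>x. h x * X x \<partial>\<mu>)"
    using ih by (simp add: Y_def X_def right_diff_distrib)
  also have "\<dots> = 0"
    using integral_mult_cond_avg[OF h ih(1)] integral_mult_cond_avg[OF depends_on_mono[OF h] ih(1), of "insert k J"]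
    by (auto simp: X_def)
  finally have orth: "(\<integral>x. sgn (X x) * \<bar>X x\<bar> powr (p - 1) * Y x \<partial>\<mu>) = 0" by (simp add: h_def)
  have "(\<integral>x. \<bar>cond_avg (insert k J) g x\<bar> powr p \<partial>\<mu>) = (\<integral>x. \<bar>X x + Y x\<bar> powr p \<partial>\<mu>)"
    by (simp add: X_def Y_def)
  also have "\<dots> \<le> A powr p + ?C * (2 * A powr (p - 2) * b k powr 2 + b k powr p)"
    using insert.IH by (intro moment_add_martingale_difference X Y orth p A b mX mY) (simp add: Ap X_def s_def)
  also have "\<dots> = (4 * ?C * s) powr (p / 2) + ?C * (2 * (4 * ?C * s) powr ((p - 2) / 2) * b k powr 2 + b k powr p)"
    by (simp only: Ap)
  also have "\<dots> \<le> (4 * ?C * (s + (b k)\<^sup>2)) powr (p / 2)"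
    by (rule moment_recursion_step[OF s b p C])
  finally show ?case using insert.hyps by (simp add: s_def add_ac)
qed

end

section \<open>Approximation by functions of finitely many coordinates\<close>

context independent_coordinates
begin

text \<open>Membership in the \<open>L\<^sup>1\<close>-closure of the functions of finitely many coordinates.\<close>
definition approximable :: "(('i \<Rightarrow> 'b) \<Rightarrow> real) \<Rightarrow> bool" where
  "approximable g \<longleftrightarrow> (\<forall>\<epsilon>>0. \<exists>J h. finite J \<and> integrable \<mu> h \<and> depends_on J h \<and> (\<integral>x. \<bar>g x - h x\<bar> \<partial>\<mu>) < \<epsilon>)"

lemma approximable_depends_on:
  assumes "finite J" "integrable \<mu> h" "depends_on J h"
  shows "approximable h"
  unfolding approximable_def using assms by (intro allI impI exI[of _ J] exI[of _ h]) simp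

lemma approximable_add:
  assumes "integrable \<mu> f" "integrable \<mu> g" "approximable f" "approximable g"
  shows "approximable (\<lambda>x. f x + g x)"
  unfolding approximable_def
proof (intro allI impI)
  fix \<epsilon> :: real assume "\<epsilon> > 0"
  then have "\<epsilon> / 2 > 0" by simp
  from assms(3)[unfolded approximable_def, rule_format, OF this]
    assms(4)[unfolded approximable_def, rule_format, OF this]
  obtain J h J' h' where *: "finite J" "integrable \<mu> h" "depends_on J h" "(\<integral>x. \<bar>f x - h x\<bar> \<partial>\<mu>) < \<epsilon> / 2"
    "finite J'" "integrable \<mu> h'" "depends_on J' h'" "(\<integral>x. \<bar>g x - h' x\<bar> \<partial>\<mu>) < \<epsilon> / 2"
    by blast
  have "(\<integral>x. \<bar>f x + g x - (h x + h' x)\<bar> \<partial>\<mu>) \<le> (\<integral>x. \<bar>f x - h x\<bar> + \<bar>g x - h' x\<bar> \<partial>\<mu>)"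
    using assms(1,2) * by (intro integral_mono) auto
  also have "\<dots> = (\<integral>x. \<bar>f x - h x\<bar> \<partial>\<mu>) + (\<integral>x. \<bar>g x - h' x\<bar> \<partial>\<mu>)"
    using assms(1,2) * by simp
  also have "\<dots> < \<epsilon>" using * by linarith
  finally have "(\<integral>x. \<bar>f x + g x - (h x + h' x)\<bar> \<partial>\<mu>) < \<epsilon>" .
  moreover have "depends_on (J \<union> J') (\<lambda>x. h x + h' x)"
    using depends_on_mono[of J h "J \<union> J'"] depends_on_mono[of J' h' "J \<union> J'"] *
    by (simp add: depends_on_def)
  ultimately show "\<exists>J h. finite J \<and> integrable \<mu> h \<and> depends_on J h \<and> (\<integral>x. \<bar>f x + g x - h x\<bar> \<partial>\<mu>) < \<epsilon>"
    using * by (intro exI[of _ "J \<union> J'"] exI[of _ "\<lambda>x. h x + h' x"]) simp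
qed

lemma approximable_cmult:
  assumes "approximable f"
  shows "approximable (\<lambda>x. c * f x)"
  unfolding approximable_def
proof (intro allI impI)
  fix \<epsilon> :: real assume "\<epsilon> > 0"
  then have "\<epsilon> / (\<bar>c\<bar> + 1) > 0" by simp
  from assms[unfolded approximable_def, rule_format, OF this]
  obtain J h where *: "finite J" "integrable \<mu> h" "depends_on J h" "(\<integral>x. \<bar>f x - h x\<bar> \<partial>\<mu>) < \<epsilon> / (\<bar>c\<bar> + 1)"
    by blast
  have "(\<integral>x. \<bar>c * f x - c * h x\<bar> \<partial>\<mu>) = \<bar>c\<bar> * (\<integral>x. \<bar>f x - h x\<bar> \<partial>\<mu>)"
    by (simp add: abs_mult flip: right_diff_distrib)
  also have "\<dots> \<le> (\<bar>c\<bar> + 1) * (\<integral>x. \<bar>f x - h x\<bar> \<partial>\<mu>)"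
    by (intro mult_right_mono) auto
  also have "\<dots> < \<epsilon>" using *(4) by (simp add: pos_less_divide_eq mult.commute add_pos_nonneg)
  finally show "\<exists>J h. finite J \<and> integrable \<mu> h \<and> depends_on J h \<and> (\<integral>x. \<bar>c * f x - h x\<bar> \<partial>\<mu>) < \<epsilon>"
    using * by (intro exI[of _ J] exI[of _ "\<lambda>x. c * h x"]) (simp add: depends_on_def)
qed

lemma approximable_dominated_limit:
  assumes f: "integrable \<mu> f" and s: "\<And>n. integrable \<mu> (s n)" "\<And>n::nat. approximable (s n)"
    and lim: "\<And>x. x \<in> space \<mu> \<Longrightarrow> (\<lambda>n. s n x) \<longlonglongrightarrow> f x"
    and w: "integrable \<mu> w" "\<And>n x. x \<in> space \<mu> \<Longrightarrow> \<bar>s n x\<bar> \<le> w x"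
  shows "approximable f"
  unfolding approximable_def
proof (intro allI impI)
  fix \<epsilon> :: real assume \<epsilon>: "\<epsilon> > 0"
  have "(\<lambda>n. \<integral>x. \<bar>f x - s n x\<bar> \<partial>\<mu>) \<longlonglongrightarrow> (\<integral>x. 0 \<partial>\<mu>)"
  proof (rule integral_dominated_convergence[where w="\<lambda>x. \<bar>f x\<bar> + w x"])
    show "AE x in \<mu>. (\<lambda>n. \<bar>f x - s n x\<bar>) \<longlonglongrightarrow> 0"
      using lim by (intro AE_I2 tendsto_rabs_zero) (auto intro!: tendsto_eq_intros)
    show "AE x in \<mu>. norm \<bar>f x - s n x\<bar> \<le> \<bar>f x\<bar> + w x" for n
    proof (rule AE_I2)
      fix x assume "x \<in> space \<mu>"
      from w(2)[OF this, of n] show "norm \<bar>f x - s n x\<bar> \<le> \<bar>f x\<bar> + w x" by simp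
    qed
  qed (use f s(1) w(1) in auto)
  then have "eventually (\<lambda>n. (\<integral>x. \<bar>f x - s n x\<bar> \<partial>\<mu>) < \<epsilon> / 2) sequentially"
    using \<epsilon> by (intro order_tendstoD(2)) auto
  then obtain n where n: "(\<integral>x. \<bar>f x - s n x\<bar> \<partial>\<mu>) < \<epsilon> / 2"
    by (auto simp: eventually_sequentially)
  have "\<epsilon> / 2 > 0" using \<epsilon> by simp
  from s(2)[unfolded approximable_def, rule_format, OF this, of n]
  obtain J h where *: "finite J" "integrable \<mu> h" "depends_on J h" "(\<integral>x. \<bar>s n x - h x\<bar> \<partial>\<mu>) < \<epsilon> / 2"
    by blast
  have "(\<integral>x. \<bar>f x - h x\<bar> \<partial>\<mu>) \<le> (\<integral>x. \<bar>f x - s n x\<bar> + \<bar>s n x - h x\<bar> \<partial>\<mu>)"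
    using f s(1) * by (intro integral_mono) auto
  also have "\<dots> = (\<integral>x. \<bar>f x - s n x\<bar> \<partial>\<mu>) + (\<integral>x. \<bar>s n x - h x\<bar> \<partial>\<mu>)"
    using f s(1) * by simp
  also have "\<dots> < \<epsilon>" using * n by linarith
  finally show "\<exists>J h. finite J \<and> integrable \<mu> h \<and> depends_on J h \<and> (\<integral>x. \<bar>f x - h x\<bar> \<partial>\<mu>) < \<epsilon>"
    using * by blast
qed

text \<open>The boxes that generate the product \<open>\<sigma>\<close>-algebra are determined by finitely many coordinates
  and stable under intersection; complements and disjoint unions stay in the \<open>L\<^sup>1\<close>-closure.\<close>
lemma approximable_indicator:
  assumes A: "A \<in> sets \<mu>"
  shows "approximable (indicator A)"
proof -
  have sp: "(\<Pi>\<^sub>E i\<in>UNIV. space (M i)) = space \<mu>" by (simp add: space_PiM)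
  have ind: "integrable \<mu> (indicator B :: _ \<Rightarrow> real)" if "B \<in> sets \<mu>" for B
    using that by (simp add: P.emeasure_eq_measure)
  have one: "approximable (\<lambda>_. 1)"
    by (rule approximable_depends_on[of "{}"]) (auto simp: depends_on_def)
  have zero: "approximable (\<lambda>_. 0)"
    by (rule approximable_depends_on[of "{}"]) (auto simp: depends_on_def)
  from A have A': "A \<in> sigma_sets (space \<mu>) (prod_algebra UNIV M)"
    unfolding sets_PiM sp .
  have into: "prod_algebra UNIV M \<subseteq> Pow (space \<mu>)"
    using prod_algebra_sets_into_space[of UNIV M] unfolding sp .
  from Int_stable_prod_algebra into A' show ?thesis
  proof (induction rule: sigma_sets_induct_disjoint)
    case (basic A)
    then obtain J E where J: "A = prod_emb UNIV M J (\<Pi>\<^sub>E j\<in>J. E j)" "finite J" "\<And>i. i \<in> J \<Longrightarrow> E i \<in> sets (M i)"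
      by (force elim!: prod_algebraE)
    have "A \<in> sets \<mu>" using J by (auto intro: sets_PiM_I)
    moreover have "depends_on J (indicator A :: _ \<Rightarrow> real)"
      unfolding depends_on_def J(1)
      by (auto simp: prod_emb_def mix_def indicator_def space_PiM PiE_iff)
    ultimately show ?case using J(2) ind by (intro approximable_depends_on)
  next
    case empty
    show ?case using zero by (simp add: indicator_def)
  next
    case (compl A)
    have A: "A \<in> sets \<mu>" using compl(1) unfolding sets_PiM sp .
    have "approximable (\<lambda>x. 1 + (-1) * indicator A x)"
      using compl(2) A ind[OF A] one by (intro approximable_add approximable_cmult) auto
    then have "approximable (\<lambda>x. 1 - indicator A x)" by simp
    moreover have "(\<integral>x. \<bar>indicator (space \<mu> - A) x - h x :: real\<bar> \<partial>\<mu>) = (\<integral>x. \<bar>1 - indicator A x - h x\<bar> \<partial>\<mu>)" for h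
      by (rule Bochner_Integration.integral_cong) (auto simp: indicator_def)
    ultimately show ?case by (simp add: approximable_def)
  next
    case (union A)
    have A: "A i \<in> sets \<mu>" for i using union(2) unfolding sets_PiM sp by auto
    have fin: "approximable (indicator (\<Union>i<n. A i))" for n
    proof (induction n)
      case 0
      show ?case using zero by (simp add: indicator_def)
    next
      case (Suc n)
      have "A n \<inter> A i = {}" if "i < n" for i
        using union(1) that by (auto simp: disjoint_family_on_def)
      then have "A n \<inter> (\<Union>i<n. A i) = {}" by blast
      then have "indicator (\<Union>i<Suc n. A i) = (\<lambda>x. indicator (A n) x + indicator (\<Union>i<n. A i) x :: real)"
        by (auto simp: lessThan_Suc indicator_def fun_eq_iff)
      moreover have "(\<Union>i<n. A i) \<in> sets \<mu>" using A by auto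
      ultimately show ?case using approximable_add[OF ind[OF A] ind union(3) Suc, of n] by simp
    qed
    show ?case
    proof (rule approximable_dominated_limit[where s="\<lambda>n. indicator (\<Union>i<n. A i)" and w="\<lambda>_. 1"])
      show "(\<lambda>n. indicator (\<Union>i<n. A i) x :: real) \<longlonglongrightarrow> indicator (\<Union>i. A i) x" for x
        by (rule LIMSEQ_indicator_UN)
      show "integrable \<mu> (indicator (\<Union>i. A i) :: _ \<Rightarrow> real)" using A by (intro ind) auto
      show "integrable \<mu> (indicator (\<Union>i<n. A i) :: _ \<Rightarrow> real)" for n using A by (intro ind) auto
      show "\<bar>indicator (\<Union>i<n. A i) x\<bar> \<le> (1 :: real)" for n x by (simp add: indicator_def)
    qed (use fin in auto)
  qed
qed

lemma integrable_imp_approximable: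
  assumes "integrable \<mu> g"
  shows "approximable g"
  using assms
proof (induction rule: integrable_induct)
  case (base A c)
  then show ?case using approximable_cmult[OF approximable_indicator[of A], of c] by (simp add: mult.commute)
next
  case (add f g)
  then show ?case by (intro approximable_add)
next
  case (lim f s)
  then show ?case by (intro approximable_dominated_limit[of f s "\<lambda>x. 2 * \<bar>f x\<bar>"]) auto
qed

text \<open>An average over the coordinates outside \<open>J\<close> fixes a function \<open>h\<close> that depends on \<open>J\<close>
  only and contracts the \<open>L\<^sup>1\<close>-distance between \<open>g\<close> and \<open>h\<close>.\<close>
lemma cond_avg_close:
  assumes g: "integrable \<mu> g" and \<epsilon>: "\<epsilon> > 0"
  shows "\<exists>J. finite J \<and> (\<integral>x. \<bar>cond_avg J g x - g x\<bar> \<partial>\<mu>) < \<epsilon>"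
proof -
  have "\<epsilon> / 2 > 0" using \<epsilon> by simp
  from integrable_imp_approximable[OF g, unfolded approximable_def, rule_format, OF this]
  obtain J h where h: "finite J" "integrable \<mu> h" "depends_on J h" "(\<integral>x. \<bar>g x - h x\<bar> \<partial>\<mu>) < \<epsilon> / 2"
    by blast
  define u where "u x = g x - h x" for x
  have u: "integrable \<mu> u" using g h by (simp add: u_def[abs_def])
  have ue: "AE x in \<mu>. cond_avg J u x = cond_avg J g x - h x"
    using AE_integrable_mix[OF g, of J] AE_integrable_mix[OF h(2), of J] AE_space
  proof eventually_elim
    case (elim x)
    then show ?case using cond_avg_eq[OF h(3), of x] by (simp add: u_def cond_avg_def)
  qed
  note i = integrable_cond_avg[OF g, of J] integrable_cond_avg[OF u, of J]
  have "(\<integral>x. \<bar>cond_avg J g x - g x\<bar> \<partial>\<mu>) \<le> (\<integral>x. \<bar>cond_avg J u x\<bar> + \<bar>u x\<bar> \<partial>\<mu>)"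
    using ue i g h(2) u by (intro integral_mono_AE) (auto simp: u_def elim!: eventually_mono)
  also have "\<dots> = (\<integral>x. \<bar>cond_avg J u x\<bar> \<partial>\<mu>) + (\<integral>x. \<bar>u x\<bar> \<partial>\<mu>)"
    using i u by simp
  also have "(\<integral>x. \<bar>cond_avg J u x\<bar> \<partial>\<mu>) \<le> (\<integral>x. \<bar>u x\<bar> \<partial>\<mu>)"
    using moment_cond_avg_le(2)[of u 1 J] u by simp
  also have "(\<integral>x. \<bar>u x\<bar> \<partial>\<mu>) + (\<integral>x. \<bar>u x\<bar> \<partial>\<mu>) < \<epsilon>" using h(4) by (simp add: u_def)
  finally show ?thesis using h(1) by auto
qed

lemma cond_avg_AE_limit:
  assumes g: "integrable \<mu> g"
  shows "\<exists>J :: nat \<Rightarrow> 'i set. (\<forall>n. finite (J n)) \<and> (AE x in \<mu>. (\<lambda>n. cond_avg (J n) g x) \<longlonglongrightarrow> g x)"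
proof -
  have "\<exists>J. \<forall>n::nat. finite (J n) \<and> (\<integral>x. \<bar>cond_avg (J n) g x - g x\<bar> \<partial>\<mu>) < 1 / (1 + real n)"
    by (intro choice allI cond_avg_close g) simp
  then obtain J where J: "\<And>n::nat. finite (J n)" "\<And>n. (\<integral>x. \<bar>cond_avg (J n) g x - g x\<bar> \<partial>\<mu>) < 1 / (1 + real n)"
    by blast
  have "\<exists>r::nat\<Rightarrow>nat. strict_mono r \<and> (AE x in \<mu>. (\<lambda>n. cond_avg (J (r n)) g x - g x) \<longlonglongrightarrow> 0)"
  proof (rule tendsto_L1_AE_subseq)
    have "(\<lambda>n. 1 / (1 + real n)) \<longlonglongrightarrow> 0" by real_asymp
    then show "(\<lambda>n. \<integral>x. norm (cond_avg (J n) g x - g x) \<partial>\<mu>) \<longlonglongrightarrow> 0"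
      by (rule Lim_null_comparison[rotated]) (use J(2) in \<open>auto intro!: always_eventually less_imp_le\<close>)
  qed (use g integrable_cond_avg in auto)
  then obtain r where "AE x in \<mu>. (\<lambda>n. cond_avg (J (r n)) g x - g x) \<longlonglongrightarrow> 0" by blast
  then have "AE x in \<mu>. (\<lambda>n. cond_avg (J (r n)) g x) \<longlonglongrightarrow> g x"
    by eventually_elim (simp add: LIM_zero_iff)
  with J(1) show ?thesis by (intro exI[of _ "\<lambda>n. J (r n)"]) auto
qed

text \<open>A Burkholder-type (for \<open>p = 2\<close>: Efron-Stein) inequality for functions of infinitely many
  independent variables. The bound for finitely many revealed coordinates is used with \<open>\<beta> = B\<close>,
  which doubles the constant, and passes to the limit by Fatou's lemma.\<close>
proposition moment_le_resampling:
  fixes g :: "('i \<Rightarrow> 'b) \<Rightarrow> real"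
  assumes g: "integrable \<mu> g" "(\<integral>x. g x \<partial>\<mu>) = 0" and gp: "integrable \<mu> (\<lambda>x. \<bar>g x\<bar> powr p)"
    and p: "p \<ge> 2" and b: "\<And>k. b k > 0"
    and res: "\<And>k. (\<integral>z. \<bar>resampling_diff k g z\<bar> powr p \<partial>(\<mu> \<Otimes>\<^sub>M \<mu>)) \<le> b k powr p"
    and B: "B > 0" "\<And>J. finite J \<Longrightarrow> (\<Sum>k\<in>J. (b k)\<^sup>2) \<le> B"
  shows "(\<integral>\<^sup>+ x. ennreal (\<bar>g x\<bar> powr p) \<partial>\<mu>) \<le> ennreal ((8 * taylor_const p * B) powr (p / 2))"
proof -
  let ?R = "ennreal ((8 * taylor_const p * B) powr (p / 2))"
  obtain J :: "nat \<Rightarrow> 'i set" where J: "\<And>n. finite (J n)" and lim: "AE x in \<mu>. (\<lambda>n. cond_avg (J n) g x) \<longlonglongrightarrow> g x"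
    using cond_avg_AE_limit[OF g(1)] by blast
  have C: "taylor_const p \<ge> 1" using taylor_const_ge_1[of p] p by simp
  have le: "(\<integral>\<^sup>+ x. ennreal (\<bar>cond_avg (J n) g x\<bar> powr p) \<partial>\<mu>) \<le> ?R" for n
  proof -
    have "(\<integral>x. \<bar>cond_avg (J n) g x\<bar> powr p \<partial>\<mu>) \<le> (4 * taylor_const p * (B + (\<Sum>k\<in>J n. (b k)\<^sup>2))) powr (p / 2)"
      by (rule moment_cond_avg_finite[OF g gp p b res B(1) J])
    also have "\<dots> \<le> (8 * taylor_const p * B) powr (p / 2)"
      using B(1) B(2)[OF J[of n]] C p by (intro powr_mono2) (auto intro!: mult_nonneg_nonneg add_nonneg_nonneg sum_nonneg)
    finally show ?thesis
      using moment_cond_avg_le(1)[OF g(1) gp, of "J n"] p by (subst nn_integral_eq_integral) auto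
  qed
  have [measurable]: "cond_avg (J n) g \<in> borel_measurable \<mu>" for n
    using integrable_cond_avg[OF g(1)] by auto
  have "(\<integral>\<^sup>+ x. ennreal (\<bar>g x\<bar> powr p) \<partial>\<mu>) = (\<integral>\<^sup>+ x. liminf (\<lambda>n. ennreal (\<bar>cond_avg (J n) g x\<bar> powr p)) \<partial>\<mu>)"
  proof (rule nn_integral_cong_AE)
    show "AE x in \<mu>. ennreal (\<bar>g x\<bar> powr p) = liminf (\<lambda>n. ennreal (\<bar>cond_avg (J n) g x\<bar> powr p))"
      using lim
    proof eventually_elim
      case (elim x)
      have "(\<lambda>n. ennreal (\<bar>cond_avg (J n) g x\<bar> powr p)) \<longlonglongrightarrow> ennreal (\<bar>g x\<bar> powr p)"
        using elim p by (intro tendsto_ennrealI tendsto_powr2 tendsto_rabs) auto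
      then show ?case by (intro lim_imp_Liminf[symmetric]) auto
    qed
  qed
  also have "\<dots> \<le> liminf (\<lambda>n. \<integral>\<^sup>+ x. ennreal (\<bar>cond_avg (J n) g x\<bar> powr p) \<partial>\<mu>)"
    by (rule nn_integral_liminf) measurable
  also have "\<dots> \<le> liminf (\<lambda>n::nat. ?R)" using le by (intro Liminf_mono always_eventually) auto
  also have "\<dots> = ?R" by (simp add: Liminf_const)
  finally show ?thesis .
qed

end

section \<open>Functions of independent random variables and their copies\<close>

text \<open>Joint independence makes the law of both families together a product over two copies of the index
  type. Splitting this product into two halves with the same factors gives the law of the pair.\<close>
lemma (in prob_space)
  fixes X X' :: "'i \<Rightarrow> 'a \<Rightarrow> 'b"
  assumes indep: "indep_vars (\<lambda>_. N) (case_sum X X') UNIV"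
    and law: "\<And>k. distr M N (X' k) = distr M N (X k)"
  defines "\<mu> \<equiv> PiM UNIV (\<lambda>k. distr M N (X k))"
  shows pair_with_copy_measurable: "(\<lambda>\<omega>. (\<lambda>k. X k \<omega>, \<lambda>k. X' k \<omega>)) \<in> M \<rightarrow>\<^sub>M \<mu> \<Otimes>\<^sub>M \<mu>" (is "?pair \<in> _")
    and distr_pair_with_copy: "distr M (\<mu> \<Otimes>\<^sub>M \<mu>) (\<lambda>\<omega>. (\<lambda>k. X k \<omega>, \<lambda>k. X' k \<omega>)) = \<mu> \<Otimes>\<^sub>M \<mu>"
proof -
  have rv: "random_variable N (case_sum X X' k)" for k
    using indep by (auto simp: indep_vars_def)
  have X: "random_variable N (X k)" "random_variable N (X' k)" for k
    using rv[of "Inl k"] rv[of "Inr k"] by auto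
  have fac: "(\<lambda>k. distr M N (case_sum X X' k)) = case_sum (\<lambda>k. distr M N (X k)) (\<lambda>k. distr M N (X k))"
    by (auto simp: fun_eq_iff law split: sum.split)
  have joint_N: "distr M (PiM UNIV (\<lambda>_. N)) (\<lambda>\<omega> k. case_sum X X' k \<omega>)
      = PiM UNIV (case_sum (\<lambda>k. distr M N (X k)) (\<lambda>k. distr M N (X k)))"
    using indep_vars_iff_distr_eq_PiM[where I=UNIV and M'="\<lambda>_. N" and X="case_sum X X'"] rv indep
    by (simp add: fac restrict_UNIV)
  interpret independent_coordinates "\<lambda>k. distr M N (X k)"
    unfolding independent_coordinates_def by (rule product_prob_spaceI, rule prob_space_distr, rule X)
  have s: "sets (PiM UNIV (\<lambda>_::'i + 'i. N)) = sets \<Pi>\<mu>"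
    by (rule sets_PiM_cong) (auto split: sum.split)
  have joint: "distr M \<Pi>\<mu> (\<lambda>\<omega> k. case_sum X X' k \<omega>) = \<Pi>\<mu>"
    unfolding joint_N[symmetric] by (rule distr_cong) auto
  have mj: "(\<lambda>\<omega> k. case_sum X X' k \<omega>) \<in> M \<rightarrow>\<^sub>M \<Pi>\<mu>"
    using rv by (subst measurable_cong_sets[OF refl s[symmetric]])
                (auto intro!: measurable_PiM_single' simp: PiE_iff dest: measurable_space)
  have split: "?pair = (\<lambda>z. (\<lambda>i. z (Inl i), \<lambda>i. z (Inr i))) \<circ> (\<lambda>\<omega> k. case_sum X X' k \<omega>)"
    by (simp add: fun_eq_iff)
  show "?pair \<in> M \<rightarrow>\<^sub>M \<mu> \<Otimes>\<^sub>M \<mu>"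
    unfolding split \<mu>_def by (rule measurable_comp[OF mj split_measurable])
  show "distr M (\<mu> \<Otimes>\<^sub>M \<mu>) ?pair = \<mu> \<Otimes>\<^sub>M \<mu>"
    unfolding split \<mu>_def
    by (subst distr_distr[OF split_measurable mj, symmetric]) (simp only: joint distr_split)
qed

text \<open>\<open>moment_le_resampling\<close> carried over from the law of the variables to the probability space on
  which they live.\<close>
proposition (in prob_space) moment_le_replacement:
  fixes X X' :: "'i \<Rightarrow> 'a \<Rightarrow> 'b" and g :: "('i \<Rightarrow> 'b) \<Rightarrow> real"
  assumes indep: "indep_vars (\<lambda>_. N) (case_sum X X') UNIV"
    and law: "\<And>k. distr M N (X' k) = distr M N (X k)"
    and g: "g \<in> borel_measurable (PiM UNIV (\<lambda>_. N))"
    and mean: "integrable M (\<lambda>\<omega>. g (\<lambda>l. X l \<omega>))" "(\<integral>\<omega>. g (\<lambda>l. X l \<omega>) \<partial>M) = 0"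
    and Lp: "integrable M (\<lambda>\<omega>. \<bar>g (\<lambda>l. X l \<omega>)\<bar> powr p)"
    and p: "p \<ge> 2" and b: "\<And>k. b k > 0"
    and rep: "\<And>k. (\<integral>\<omega>. \<bar>g (\<lambda>l. X l \<omega>) - g ((\<lambda>l. X l \<omega>)(k := X' k \<omega>))\<bar> powr p \<partial>M) \<le> b k powr p"
    and B: "B > 0" "\<And>J. finite J \<Longrightarrow> (\<Sum>k\<in>J. (b k)\<^sup>2) \<le> B"
  shows "(\<integral>\<^sup>+ \<omega>. ennreal (\<bar>g (\<lambda>l. X l \<omega>)\<bar> powr p) \<partial>M) \<le> ennreal ((8 * taylor_const p * B) powr (p / 2))"
proof -
  have "random_variable N (case_sum X X' k)" for k
    using indep by (auto simp: indep_vars_def)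
  from this[of "Inl k" for k] have X: "random_variable N (X k)" for k by simp
  interpret I: independent_coordinates "\<lambda>k. distr M N (X k)"
    unfolding independent_coordinates_def by (rule product_prob_spaceI, rule prob_space_distr, rule X)
  define pr where "pr \<omega> = (\<lambda>k. X k \<omega>, \<lambda>k. X' k \<omega>)" for \<omega>
  have pm: "pr \<in> M \<rightarrow>\<^sub>M I.\<mu> \<Otimes>\<^sub>M I.\<mu>" and pd: "distr M (I.\<mu> \<Otimes>\<^sub>M I.\<mu>) pr = I.\<mu> \<Otimes>\<^sub>M I.\<mu>"
    using pair_with_copy_measurable[OF indep law] distr_pair_with_copy[OF indep law] by (simp_all add: pr_def[abs_def])
  have Xm: "(\<lambda>\<omega> k. X k \<omega>) \<in> M \<rightarrow>\<^sub>M I.\<mu>"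
    using measurable_compose[OF pm measurable_fst] by (simp add: pr_def)
  have Xd: "distr M I.\<mu> (\<lambda>\<omega> k. X k \<omega>) = I.\<mu>"
  proof -
    have "distr M I.\<mu> (\<lambda>\<omega> k. X k \<omega>) = distr (distr M (I.\<mu> \<Otimes>\<^sub>M I.\<mu>) pr) I.\<mu> fst"
      by (subst distr_distr[OF measurable_fst pm]) (simp add: comp_def pr_def)
    also have "\<dots> = I.\<mu>" by (simp add: pd I.P.distr_pair_fst)
    finally show ?thesis .
  qed
  have gm: "g \<in> borel_measurable I.\<mu>"
    using g by (subst measurable_cong_sets[of _ "PiM UNIV (\<lambda>_. N)"]) (auto intro!: sets_PiM_cong)
  have "(\<integral>\<^sup>+ x. ennreal (\<bar>g x\<bar> powr p) \<partial>I.\<mu>) \<le> ennreal ((8 * taylor_const p * B) powr (p / 2))"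
  proof (rule I.moment_le_resampling[OF _ _ _ p b _ B])
    show "integrable I.\<mu> g"
      using integrable_distr_eq[OF Xm gm] mean(1) by (simp add: Xd)
    show "(\<integral>x. g x \<partial>I.\<mu>) = 0"
      using integral_distr[OF Xm gm] mean(2) by (simp add: Xd)
    have gp: "(\<lambda>x. \<bar>g x\<bar> powr p) \<in> borel_measurable I.\<mu>" using gm by measurable
    show "integrable I.\<mu> (\<lambda>x. \<bar>g x\<bar> powr p)"
      using integrable_distr_eq[OF Xm gp] Lp by (simp add: Xd)
    fix k
    have "(\<lambda>z. \<bar>I.resampling_diff k g z\<bar> powr p) \<in> borel_measurable (I.\<mu> \<Otimes>\<^sub>M I.\<mu>)"
      using gm I.mix_comp_measurable[OF gm, of "- {k}"] by (simp add: I.resampling_diff_def[abs_def])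
    from integral_distr[OF pm this]
    have "(\<integral>z. \<bar>I.resampling_diff k g z\<bar> powr p \<partial>(I.\<mu> \<Otimes>\<^sub>M I.\<mu>))
        = (\<integral>\<omega>. \<bar>g (\<lambda>l. X l \<omega>) - g ((\<lambda>l. X l \<omega>)(k := X' k \<omega>))\<bar> powr p \<partial>M)"
      by (simp add: pd I.resampling_diff_def I.mix_Compl_singleton pr_def)
    with rep show "(\<integral>z. \<bar>I.resampling_diff k g z\<bar> powr p \<partial>(I.\<mu> \<Otimes>\<^sub>M I.\<mu>)) \<le> b k powr p" by simp
  qed
  moreover have "(\<integral>\<^sup>+ x. ennreal (\<bar>g x\<bar> powr p) \<partial>I.\<mu>) = (\<integral>\<^sup>+ \<omega>. ennreal (\<bar>g (\<lambda>l. X l \<omega>)\<bar> powr p) \<partial>M)"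
    using nn_integral_distr[OF Xm, of "\<lambda>x. ennreal (\<bar>g x\<bar> powr p)"] gm by (simp add: Xd)
  ultimately show ?thesis by simp
qed

section \<open>Short range dependent fields\<close>

definition shift_array :: "nat \<Rightarrow> nat \<Rightarrow> (int \<times> int \<Rightarrow> real) \<Rightarrow> int \<times> int \<Rightarrow> real" where
  "shift_array i j z = (\<lambda>(u, v). z (int i - u, int j - v))"

lemma lagged_eq_shift_array: "lagged e i j \<omega> = shift_array i j (\<lambda>k. e k \<omega>)"
  by (simp add: lagged_def shift_array_def)

lemma shift_array_measurable:
  "shift_array i j \<in> PiM UNIV (\<lambda>_. borel) \<rightarrow>\<^sub>M PiM UNIV (\<lambda>_. borel)"
  by (rule measurable_PiM_single') (auto simp: shift_array_def split_beta')

text \<open>The dependence measure refers to a lag. The innovation at the fixed site \<open>k\<close> has lag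
  \<open>k - (i, j)\<close> from the site \<open>(i, j)\<close>.\<close>
lemma moment_norm_le_dependence_measure:
  assumes "i \<in> {1..n}" "j \<in> {1..m}"
  shows "moment_norm P M (\<lambda>\<omega>. G n m i j (lagged e i j \<omega>) - G n m i j (lagged (e(k := e' k)) i j \<omega>))
           \<le> dependence_measure P M G e e' n m (fst k - int i) (snd k - int j)"
proof -
  have "moment_norm P M (\<lambda>\<omega>. G n m i j (lagged e i j \<omega>) - G n m i j (lagged (e(k := e' k)) i j \<omega>))
     = (case (i, j) of (i', j') \<Rightarrow> let k' = (int i' + (fst k - int i), int j' + (snd k - int j)) in
        moment_norm P M (\<lambda>\<omega>. G n m i' j' (lagged e i' j' \<omega>) - G n m i' j' (lagged (e(k' := e' k')) i' j' \<omega>)))"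
    by simp
  also have "\<dots> \<le> dependence_measure P M G e e' n m (fst k - int i) (snd k - int j)"
    unfolding dependence_measure_def using assms by (intro Max_ge imageI) auto
  finally show ?thesis .
qed

lemma ennreal_le_divide_of_mult_le:
  assumes "w > 0" "K \<ge> 0" "ennreal w * x \<le> ennreal K"
  shows "x \<le> ennreal (K / w)"
proof (cases x rule: ennreal_cases)
  case (real r)
  have "ennreal (w * r) \<le> ennreal K"
    using assms real by (metis ennreal_mult less_imp_le)
  then have "w * r \<le> K" using assms(2) by (simp only: ennreal_le_iff)
  then show ?thesis using real assms(1) by (simp add: pos_le_divide_eq mult.commute ennreal_leI)
next
  case top
  have "ennreal w \<noteq> 0" using assms(1) by simp
  then have "ennreal w * x = \<infinity>" using top by (simp add: ennreal_mult_eq_top_iff)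
  with assms(3) show ?thesis by (simp add: top_unique)
qed

theorem lemma1:
  fixes P :: "'a measure" and M \<alpha> :: real
    and eps :: "nat \<Rightarrow> nat \<Rightarrow> nat \<Rightarrow> nat \<Rightarrow> 'a \<Rightarrow> real"
  assumes "prob_space P"
    and "M > 4" and "\<alpha> > 3"
    and "short_range_dependent P M \<alpha> eps"
  shows "\<exists>C::real. 0 \<le> C \<and>
    (\<forall>n\<ge>1. \<forall>m\<ge>1. \<forall>a :: nat \<Rightarrow> nat \<Rightarrow> real.
       moment_norm P M (\<lambda>\<omega>. \<Sum>i=1..n. \<Sum>j=1..m. a i j * eps n m i j \<omega>)
         \<le> ennreal (C * sqrt (\<Sum>i=1..n. \<Sum>j=1..m. (a i j)\<^sup>2)))"
proof -
  interpret prob_space P by fact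
  from assms(4) obtain e e' G K1 K2 where inn: "innovations_with_copy P e e'"
    and field: "\<forall>n\<ge>1. \<forall>m\<ge>1. \<forall>i\<in>{1..n}. \<forall>j\<in>{1..m}.
           G n m i j \<in> borel_measurable (\<Pi>\<^sub>M k\<in>UNIV. borel) \<and>
           (\<forall>\<omega>\<in>space P. eps n m i j \<omega> = G n m i j (lagged e i j \<omega>)) \<and>
           has_bochner_integral P (eps n m i j) 0"
    and moments: "\<forall>n\<ge>1. \<forall>m\<ge>1.
           (MAX (i, j) \<in> {1..n} \<times> {1..m}. moment_norm P M (eps n m i j)) \<le> ennreal K1"
    and decay: "\<forall>n\<ge>1. \<forall>m\<ge>1.
           (SUP (p, q). ennreal ((1 + \<bar>real_of_int p\<bar> + \<bar>real_of_int q\<bar>) powr \<alpha>)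
              * dependence_measure P M G e e' n m p q) \<le> ennreal K2"
    unfolding short_range_dependent_def by (elim exE conjE) (rule that)
  have G: "G n m i j \<in> borel_measurable (\<Pi>\<^sub>M k\<in>UNIV. borel)"
    and eps: "\<omega> \<in> space P \<Longrightarrow> eps n m i j \<omega> = G n m i j (lagged e i j \<omega>)"
    and mean: "has_bochner_integral P (eps n m i j) 0"
    if "n \<ge> 1" "m \<ge> 1" "i \<in> {1..n}" "j \<in> {1..m}" for n m i j \<omega>
    using field[rule_format, OF that] by simp_all
  have indep: "indep_vars (\<lambda>_. borel) (case_sum e e') UNIV"
    and law: "\<And>k. distr P borel (e' k) = distr P borel (e k)"
    using inn by (auto simp: innovations_with_copy_def)
  have e: "e k \<in> borel_measurable P" "e' k \<in> borel_measurable P" for k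
  proof -
    have "random_variable borel (case_sum e e' l)" for l
      using indep by (auto simp: indep_vars_def)
    from this[of "Inl k"] this[of "Inr k"] show "e k \<in> borel_measurable P" "e' k \<in> borel_measurable P" by auto
  qed
  \<comment> \<open>Positive, so that \<open>c\<close> below is positive.\<close>
  define K where "K = max K1 (max K2 1)"
  have K: "K \<ge> K1" "K \<ge> K2" "K > 0" by (auto simp: K_def)
  define w where "w x = 1 + \<bar>real_of_int (fst x)\<bar> + \<bar>real_of_int (snd x)\<bar>" for x :: "int \<times> int"
  have w: "w x > 0" for x by (simp add: w_def add_pos_nonneg)
  \<comment> \<open>The decay assumption says that the dependence measure at lag \<open>x\<close> is at most \<open>c x\<close>.\<close>
  define c where "c x = K * w x powr - \<alpha>" for x
  have c: "c x > 0" for x using K w[of x] by (simp add: c_def)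
  obtain D0 where D0: "\<And>J. finite J \<Longrightarrow> (\<Sum>x\<in>J. w x powr - \<alpha>) \<le> D0"
    using sum_lattice_powr_bounded[of \<alpha>] assms(3) unfolding w_def by auto
  define D where "D = K * max D0 1"
  have D: "(\<Sum>x\<in>J. c x) \<le> D" if "finite J" for J
    using D0[OF that] K by (simp add: c_def D_def flip: sum_distrib_left)
  have Dpos: "D > 0" using K by (simp add: D_def)
  define C where "C = sqrt (8 * taylor_const M) * D"
  have tc: "taylor_const M \<ge> 1" using taylor_const_ge_1[of M] assms(2) by simp
  have "moment_norm P M (\<lambda>\<omega>. \<Sum>i=1..n. \<Sum>j=1..m. a i j * eps n m i j \<omega>)
         \<le> ennreal (C * sqrt (\<Sum>i=1..n. \<Sum>j=1..m. (a i j)\<^sup>2))"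
    if nm: "n \<ge> 1" "m \<ge> 1" for n m and a :: "nat \<Rightarrow> nat \<Rightarrow> real"
  proof -
    define T where "T = {1..n} \<times> {1..m}"
    define A where "A s = a (fst s) (snd s)" for s
    define \<phi> where "\<phi> s = (int (fst s), int (snd s))" for s :: "nat \<times> nat"
    define X where "X s = eps n m (fst s) (snd s)" for s
    define f where "f s z = G n m (fst s) (snd s) (shift_array (fst s) (snd s) z)" for s z
    define g where "g z = (\<Sum>s\<in>T. A s * f s z)" for z
    have T: "finite T" "\<And>s. s \<in> T \<Longrightarrow> fst s \<in> {1..n} \<and> snd s \<in> {1..m}" by (auto simp: T_def)
    have inj: "inj_on \<phi> T" by (auto simp: inj_on_def \<phi>_def prod_eq_iff)
    have sumX: "(\<Sum>i=1..n. \<Sum>j=1..m. a i j * eps n m i j \<omega>) = (\<Sum>s\<in>T. A s * X s \<omega>)" for \<omega>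
      by (simp add: sum.cartesian_product T_def A_def X_def split_beta')
    have sumA: "(\<Sum>i=1..n. \<Sum>j=1..m. (a i j)\<^sup>2) = (\<Sum>s\<in>T. (A s)\<^sup>2)"
      by (simp add: sum.cartesian_product T_def A_def split_beta')
    have fm: "f s \<in> borel_measurable (PiM UNIV (\<lambda>_. borel))" if "s \<in> T" for s
    proof -
      have "G n m (fst s) (snd s) \<in> borel_measurable (PiM UNIV (\<lambda>_. borel))"
        using T(2)[OF that] by (intro G nm) auto
      from measurable_compose[OF shift_array_measurable this] show ?thesis
        by (simp add: f_def[abs_def])
    qed
    have gm: "g \<in> borel_measurable (PiM UNIV (\<lambda>_. borel))"
      unfolding g_def[abs_def] by (intro borel_measurable_sum borel_measurable_times borel_measurable_const fm)
    have Xf: "X s \<omega> = f s (\<lambda>l. e l \<omega>)" if "s \<in> T" "\<omega> \<in> space P" for s \<omega>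
      using eps[OF nm, of "fst s" "snd s" \<omega>] T(2)[OF that(1)] that(2)
      by (simp add: X_def f_def lagged_eq_shift_array)
    have Xg: "(\<Sum>s\<in>T. A s * X s \<omega>) = g (\<lambda>l. e l \<omega>)" if "\<omega> \<in> space P" for \<omega>
      unfolding g_def using Xf that by (intro sum.cong) auto
    have Xi: "has_bochner_integral P (X s) 0" if "s \<in> T" for s
      unfolding X_def using mean[OF nm] T(2)[OF that] by blast
    then have Xm: "X s \<in> borel_measurable P" if "s \<in> T" for s
      using that by (auto dest: has_bochner_integral.cases)
    \<comment> \<open>With all coefficients zero, the bounds \<open>b k\<close> below would not be positive.\<close>
    show ?thesis
    proof (cases "(\<Sum>s\<in>T. (A s)\<^sup>2) = 0")
      case True
      then have "\<forall>s\<in>T. A s = 0" using T(1) by (simp add: sum_nonneg_eq_0_iff)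
      then have "moment_norm P M (\<lambda>\<omega>. \<Sum>s\<in>T. A s * X s \<omega>) = 0"
        using assms(2) by (simp add: moment_norm_def)
      then show ?thesis unfolding sumX by simp
    next
      case False
      then have Apos: "(\<Sum>s\<in>T. (A s)\<^sup>2) > 0" by (simp add: sum_nonneg less_le)
      then obtain s0 where s0: "s0 \<in> T" "A s0 \<noteq> 0"
        by (metis (mono_tags, lifting) less_irrefl sum.neutral zero_power2)
      define b where "b k = (\<Sum>s\<in>T. \<bar>A s\<bar> * c (k - \<phi> s))" for k
      have b: "b k > 0" for k
        unfolding b_def by (rule sum_pos2[OF T(1) s0(1)]) (use s0 c in \<open>auto simp: less_imp_le\<close>)
      define B where "B = D\<^sup>2 * (\<Sum>s\<in>T. (A s)\<^sup>2)"
      have B: "B > 0" using Apos Dpos by (simp add: B_def)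
      have bB: "(\<Sum>k\<in>J. (b k)\<^sup>2) \<le> B" if "finite J" for J
        unfolding b_def B_def using convolution_square_sum_le[OF T(1) that _ D inj] c by (simp add: less_imp_le)
      have mnX: "(\<integral>\<^sup>+ \<omega>. ennreal (\<bar>X s \<omega>\<bar> powr M) \<partial>P) \<le> ennreal (K powr M)" if "s \<in> T" for s
      proof -
        have "moment_norm P M (X s) = (case s of (i, j) \<Rightarrow> moment_norm P M (eps n m i j))"
          by (simp add: X_def split_beta')
        also have "\<dots> \<le> (MAX (i, j) \<in> T. moment_norm P M (eps n m i j))"
          using that T(1) by (intro Max_ge) auto
        also have "\<dots> \<le> ennreal K1" unfolding T_def using moments nm by blast
        also have "\<dots> \<le> ennreal K" using K by (intro ennreal_leI)
        finally show ?thesis using K assms(2) by (simp add: moment_norm_le_iff)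
      qed
      have dep: "(\<integral>\<^sup>+ \<omega>. ennreal (\<bar>f s (\<lambda>l. e l \<omega>) - f s ((\<lambda>l. e l \<omega>)(k := e' k \<omega>))\<bar> powr M) \<partial>P)
          \<le> ennreal (c (k - \<phi> s) powr M)" if s: "s \<in> T" for s k
      proof -
        define p where "p = fst k - int (fst s)"
        define q where "q = snd k - int (snd s)"
        have upd: "(\<lambda>l. (e(k := e' k)) l \<omega>) = (\<lambda>l. e l \<omega>)(k := e' k \<omega>)" for \<omega> by auto
        have "ennreal (w (p, q) powr \<alpha>) * dependence_measure P M G e e' n m p q \<le>
            (SUP (p, q). ennreal ((1 + \<bar>real_of_int p\<bar> + \<bar>real_of_int q\<bar>) powr \<alpha>)
              * dependence_measure P M G e e' n m p q)"
          by (rule SUP_upper2[of "(p, q)"]) (auto simp: w_def)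
        also have "\<dots> \<le> ennreal K2" using decay nm by blast
        also have "\<dots> \<le> ennreal K" using K by (intro ennreal_leI)
        finally have "dependence_measure P M G e e' n m p q \<le> ennreal (K / w (p, q) powr \<alpha>)"
          using w[of "(p, q)"] K by (intro ennreal_le_divide_of_mult_le) auto
        also have "K / w (p, q) powr \<alpha> = c (k - \<phi> s)"
          by (simp add: c_def p_def q_def w_def \<phi>_def powr_minus divide_inverse)
        finally have "dependence_measure P M G e e' n m p q \<le> ennreal (c (k - \<phi> s))" .
        moreover have "moment_norm P M (\<lambda>\<omega>. f s (\<lambda>l. e l \<omega>) - f s ((\<lambda>l. e l \<omega>)(k := e' k \<omega>)))
            \<le> dependence_measure P M G e e' n m p q"
          using moment_norm_le_dependence_measure[of "fst s" n "snd s" m P M G e k e'] T(2)[OF s]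
          by (simp only: lagged_eq_shift_array f_def p_def q_def upd)
        ultimately show ?thesis
          using c[of "k - \<phi> s"] assms(2) by (simp flip: moment_norm_le_iff)
      qed
      have em: "(\<lambda>\<omega> l. e l \<omega>) \<in> P \<rightarrow>\<^sub>M PiM UNIV (\<lambda>_. borel)"
        using e by (intro measurable_PiM_single') auto
      have eum: "(\<lambda>\<omega>. (\<lambda>l. e l \<omega>)(k := e' k \<omega>)) \<in> P \<rightarrow>\<^sub>M PiM UNIV (\<lambda>_. borel)" for k
        using e by (intro measurable_PiM_single') auto
      have "(\<integral>\<^sup>+ \<omega>. ennreal (\<bar>g (\<lambda>l. e l \<omega>)\<bar> powr M) \<partial>P) \<le> ennreal ((8 * taylor_const M * B) powr (M / 2))"
      proof (rule moment_le_replacement[OF indep law gm _ _ _ _ b _ B bB])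
        have hb: "has_bochner_integral P (\<lambda>\<omega>. \<Sum>s\<in>T. A s * X s \<omega>) (\<Sum>s\<in>T. A s * 0)"
          using Xi by (intro has_bochner_integral_sum has_bochner_integral_mult_right) auto
        have hb': "has_bochner_integral P (\<lambda>\<omega>. g (\<lambda>l. e l \<omega>)) 0"
          using hb by (subst has_bochner_integral_cong[OF refl _ refl, of _ _ "\<lambda>\<omega>. \<Sum>s\<in>T. A s * X s \<omega>"]) (auto simp: Xg)
        then show "integrable P (\<lambda>\<omega>. g (\<lambda>l. e l \<omega>))" "(\<integral>\<omega>. g (\<lambda>l. e l \<omega>) \<partial>P) = 0"
          by (auto simp: has_bochner_integral_iff)
        have "(\<integral>\<^sup>+ \<omega>. ennreal (\<bar>g (\<lambda>l. e l \<omega>)\<bar> powr M) \<partial>P)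
            = (\<integral>\<^sup>+ \<omega>. ennreal (\<bar>\<Sum>s\<in>T. A s * X s \<omega>\<bar> powr M) \<partial>P)"
          by (rule nn_integral_cong) (simp add: Xg)
        also have "\<dots> \<le> ennreal ((\<Sum>s\<in>T. \<bar>A s\<bar> * K) powr M)"
          using assms(2) K Xm mnX by (intro moment_linear_combination_le T) auto
        also have "\<dots> < \<infinity>" by simp
        finally show "integrable P (\<lambda>\<omega>. \<bar>g (\<lambda>l. e l \<omega>)\<bar> powr M)"
          using measurable_compose[OF em gm] by (intro integrableI_bounded) auto
        fix k
        have "g (\<lambda>l. e l \<omega>) - g ((\<lambda>l. e l \<omega>)(k := e' k \<omega>))
            = (\<Sum>s\<in>T. A s * (f s (\<lambda>l. e l \<omega>) - f s ((\<lambda>l. e l \<omega>)(k := e' k \<omega>))))" for \<omega>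
          by (simp only: g_def right_diff_distrib sum_subtractf)
        moreover have "(\<integral>\<^sup>+ \<omega>. ennreal (\<bar>\<Sum>s\<in>T. A s * (f s (\<lambda>l. e l \<omega>) - f s ((\<lambda>l. e l \<omega>)(k := e' k \<omega>)))\<bar> powr M) \<partial>P)
            \<le> ennreal (b k powr M)"
          unfolding b_def using assms(2) c dep measurable_compose[OF em fm] measurable_compose[OF eum fm]
          by (intro moment_linear_combination_le T) auto
        ultimately show "(\<integral>\<omega>. \<bar>g (\<lambda>l. e l \<omega>) - g ((\<lambda>l. e l \<omega>)(k := e' k \<omega>))\<bar> powr M \<partial>P) \<le> b k powr M"
          by (intro integral_real_bounded) auto
      qed (use assms(2) in auto)
      also have "(8 * taylor_const M * B) powr (M / 2) = (C * sqrt (\<Sum>s\<in>T. (A s)\<^sup>2)) powr M"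
      proof -
        have "C * sqrt (\<Sum>s\<in>T. (A s)\<^sup>2) = sqrt (8 * taylor_const M * B)"
          using Dpos by (simp add: C_def B_def real_sqrt_mult)
        also have "\<dots> = (8 * taylor_const M * B) powr (1 / 2)"
          using tc B by (simp add: powr_half_sqrt)
        finally show ?thesis by (simp add: powr_powr)
      qed
      also have "(\<integral>\<^sup>+ \<omega>. ennreal (\<bar>g (\<lambda>l. e l \<omega>)\<bar> powr M) \<partial>P)
            = (\<integral>\<^sup>+ \<omega>. ennreal (\<bar>\<Sum>s\<in>T. A s * X s \<omega>\<bar> powr M) \<partial>P)"
        by (rule nn_integral_cong) (simp add: Xg)
      finally have "moment_norm P M (\<lambda>\<omega>. \<Sum>s\<in>T. A s * X s \<omega>) \<le> ennreal (C * sqrt (\<Sum>s\<in>T. (A s)\<^sup>2))"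
        using assms(2) tc Dpos by (subst moment_norm_le_iff) (auto simp: C_def intro!: mult_nonneg_nonneg sum_nonneg)
      then show ?thesis unfolding sumX sumA .
    qed
  qed
  moreover have "C \<ge> 0" using tc Dpos by (simp add: C_def)
  ultimately show ?thesis by blast
qed

end
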